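(* Let $Q$ be a quiver of type $A_n$ with vertex set $\mathcal I=\{1,\dots,n\}$ and associated skew-symmetric matrix $B$. Then there exists a pseudo-acyclic ordering for $Q$, that is, a linear ordering $\prec$ on $\mathcal I$ such that whenever $\boldsymbol{w}$ and $\boldsymbol{v}$ are two mutation sequences with $C^{\boldsymbol{w}}=C^{\boldsymbol{v}}$, one has $$\pi(r_i^{\boldsymbol{w}})=\pi(r_i^{\boldsymbol{v}})\qquad\text{for all } i=1,\dots,n,$$ where $\pi$ is the representation determined by $\prec$ and its associated generalized intersection matrix.
   Context: Quivers. A quiver $Q$ (no loops, no oriented 2-cycles) with vertex set $\mathcal I=\{1,\dots,n\}$ is identified with the skew-symmetric integer matrix $B=[b_{ij}]$: when $b_{ij}>0$ there are $b_{ij}$ arrows from $i$ to $j$. A quiver of type $A_n$ is any quiver that is mutation-equivalent (reachable by finitely many mutations) to an orientation of a type $A_n$ Dynkin diagram; it need not be acyclic. Mutation. A mutation sequence is a finite (possibly empty) word $\boldsymbol{w}=[i_1,\dots,i_\ell]$ in $\mathcal I$; $\boldsymbol{w}[k]$ denotes $[i_1,\dots,i_\ell,k]$. For an $n\times 2n$ integer matrix $M=[m_{ij}]$, put $M^{[\,]}=M$ and, inductively, $m_{ij}^{\boldsymbol{w}[k]}=-m_{ij}^{\boldsymbol{w}}$ if $i=k$ or $j=k$, and $m_{ij}^{\boldsymbol{w}[k]}=m_{ij}^{\boldsymbol{w}}+\mathrm{sgn}(m_{ik}^{\boldsymbol{w}})\max(m_{ik}^{\boldsymbol{w}}m_{kj}^{\boldsymbol{w}},0)$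 otherwise, where $\mathrm{sgn}\in\{1,0,-1\}$. Starting from $M=[B\ \ I]$ write $M^{\boldsymbol{w}}=[B^{\boldsymbol{w}}\ \ C^{\boldsymbol{w}}]$, $B^{\boldsymbol{w}}=[b_{ij}^{\boldsymbol{w}}]$, and let $c_i^{\boldsymbol{w}}$ be the $i$-th row of $C^{\boldsymbol{w}}$ (the $c$-vectors). For a nonzero vector $c\in\mathbb Z^n$, $c>0$ means all entries are non-negative and $c<0$ means all entries are non-positive (each $c$-vector is nonzero and satisfies one of these). Reflections. $\mathcal W$ is the universal Coxeter group generated by $s_1,\dots,s_n$ with relations $s_i^2=1$ only. Define $r_i^{\boldsymbol{w}}\in\mathcal W$ inductively by $r_i=r_i^{[\,]}=s_i$ and $r_i^{\boldsymbol{w}[k]}=r_k^{\boldsymbol{w}}r_i^{\boldsymbol{w}}r_k^{\boldsymbol{w}}$ if $b_{ik}^{\boldsymbol{w}}c_k^{\boldsymbol{w}}>0$, and $r_i^{\boldsymbol{w}[k]}=r_i^{\boldsymbol{w}}$ otherwise. Representation. A linear ordering $\prec$ on $\mathcal I$ determines the generalized intersection matrix $A=[a_{ij}]$ with $a_{ij}=b_{ij}$ if $i\prec j$, $a_{ii}=2$, $a_{ij}=-b_{ij}$ if $i\succ j$, and the representation $\pi$ of $\mathcal W$ on $\Gamma=\bigoplus_{i=1}^n\mathbb Z\alpha_i$ by $\pi(s_i)(\alpha_j)=\alpha_j-a_{ji}\alpha_i$. *)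

theory Defs
  imports "HOL-Analysis.Finite_Cartesian_Product"
begin

text \<open>
  The vertex set of a quiver is an arbitrary finite type \<open>'n\<close>, with \<open>n = CARD('n)\<close>.
  Quivers are identified with skew-symmetric integer matrices.  The \<open>n \<times> 2n\<close> matrices
  \<open>[B C]\<close> have the column index type \<open>'n + 'n\<close>: \<open>Inl\<close> indexes the columns of \<open>B\<close> and
  \<open>Inr\<close> those of \<open>C\<close>.
\<close>

section \<open>Mutation\<close>

definition quiver :: "int^'n^'n \<Rightarrow> bool" where
  "quiver B \<longleftrightarrow> transpose B = - B"

definition mutate :: "'n \<Rightarrow> int^('n + 'n)^'n \<Rightarrow> int^('n + 'n)^'n" where
  "mutate k M = (\<chi> i j.
     if i = k \<or> j = Inl k then - (M $ i $ j)
     else M $ i $ j + sgn (M $ i $ Inl k) * max (M $ i $ Inl k * M $ k $ j) 0)"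

definition framed :: "int^'n^'n \<Rightarrow> int^('n + 'n)^'n" where
  "framed B = (\<chi> i j. case j of Inl l \<Rightarrow> B $ i $ l | Inr l \<Rightarrow> (mat 1 :: int^'n^'n) $ i $ l)"

text \<open>Mutation sequences are read from left to right; \<open>w @ [k]\<close> is \<open>w[k]\<close>.\<close>

function mutations :: "int^'n^'n \<Rightarrow> 'n list \<Rightarrow> int^('n + 'n)^'n" where
  "mutations B [] = framed B"
| "mutations B (w @ [k]) = mutate k (mutations B w)"
  by (auto, metis rev_exhaust)
termination by (relation "measure (length \<circ> snd)") auto

definition bmat :: "int^'n^'n \<Rightarrow> 'n list \<Rightarrow> int^'n^'n" where
  "bmat B w = (\<chi> i j. mutations B w $ i $ Inl j)"

definition cmat :: "int^'n^'n \<Rightarrow> 'n list \<Rightarrow> int^'n^'n" where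
  "cmat B w = (\<chi> i j. mutations B w $ i $ Inr j)"

definition cvec :: "int^'n^'n \<Rightarrow> 'n list \<Rightarrow> 'n \<Rightarrow> int^'n" where
  "cvec B w i = row i (cmat B w)"

section \<open>Quivers of type A\<close>

text \<open>An orientation of the path with \<open>n\<close> vertices, the vertices being labelled arbitrarily:
  \<open>f 1, \<dots>, f n\<close> are the vertices in the order in which they occur along the path.\<close>

definition dynkin_A_orientation :: "int^'n^'n \<Rightarrow> bool" where
  "dynkin_A_orientation B \<longleftrightarrow> quiver B \<and>
     (\<exists>f. bij_betw f {1..CARD('n)} (UNIV :: 'n set) \<and>
        (\<forall>p\<in>{1..CARD('n)}. \<forall>q\<in>{1..CARD('n)}.
           \<bar>B $ f p $ f q\<bar> = (if q = p + 1 \<or> p = q + 1 then 1 else 0)))"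

text \<open>Since \<open>mutate k\<close> is an involution, the direction of reachability is immaterial.\<close>

definition mutation_equivalent :: "int^'n^'n \<Rightarrow> int^'n^'n \<Rightarrow> bool" where
  "mutation_equivalent B B' \<longleftrightarrow> (\<exists>w. B' = bmat B w)"

definition quiver_type_A :: "int^'n^'n \<Rightarrow> bool" where
  "quiver_type_A B \<longleftrightarrow> quiver B \<and> (\<exists>B0. dynkin_A_orientation B0 \<and> mutation_equivalent B0 B)"

section \<open>The universal Coxeter group\<close>

text \<open>Words in the generators modulo the congruence generated by \<open>s\<^sub>i s\<^sub>i = 1\<close>.\<close>

definition cancel_pair :: "'n list \<Rightarrow> 'n list \<Rightarrow> bool" where
  "cancel_pair x y \<longleftrightarrow> (\<exists>u i v. x = u @ [i, i] @ v \<and> y = u @ v)"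

quotient_type 'n ucox = "'n list" / "equivclp cancel_pair"
  by (simp add: equivp_reflp_symp_transp)

lemma equivclp_cancel_pair_append:
  assumes "equivclp cancel_pair x x'" and "equivclp cancel_pair y y'"
  shows "equivclp cancel_pair (x @ y) (x' @ y')"
proof -
  have single: "cancel_pair (a @ b @ c) (a @ b' @ c)" if "cancel_pair b b'"
    for a b b' c :: "'a list"
    using that unfolding cancel_pair_def by (metis append.assoc)
  have ctx: "equivclp cancel_pair (a @ b @ c) (a @ b' @ c)" if "equivclp cancel_pair b b'"
    for a b b' c :: "'a list"
    using that
  proof (induction rule: equivclp_induct)
    case base
    show ?case by simp
  next
    case (step y z)
    then show ?case
      by (meson single equivclp_into_equivclp)
  qed
  have "equivclp cancel_pair (x @ y) (x' @ y)"
    using ctx[OF assms(1), of "[]" y] by simp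
  also have "equivclp cancel_pair (x' @ y) (x' @ y')"
    using ctx[OF assms(2), of x' "[]"] by simp
  finally (equivclp_trans) show ?thesis .
qed

instantiation ucox :: (type) monoid_mult
begin

lift_definition one_ucox :: "'a ucox" is "[]" .

lift_definition times_ucox :: "'a ucox \<Rightarrow> 'a ucox \<Rightarrow> 'a ucox" is append
  by (rule equivclp_cancel_pair_append)

instance
  by standard (transfer; simp)+

end

lift_definition gen :: "'n \<Rightarrow> 'n ucox" is "\<lambda>i. [i]" .

lemma gen_square: "gen i * gen i = 1"
  by transfer (auto simp: cancel_pair_def intro!: r_into_equivclp exI[of _ "[]"])

lemma ucox_inverse: "\<exists>h. g * h = 1 \<and> h * g = (1 :: 'n ucox)"
proof transfer
  fix w :: "'n list"
  have right: "equivclp cancel_pair (u @ rev u) []" for u :: "'n list"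
  proof (induction u)
    case Nil
    show ?case by simp
  next
    case (Cons i u)
    have "equivclp cancel_pair ([i] @ (u @ rev u) @ [i]) ([i] @ [] @ [i])"
      by (intro equivclp_cancel_pair_append Cons.IH) auto
    also have "equivclp cancel_pair ([i] @ [] @ [i]) []"
      by (auto simp: cancel_pair_def intro!: r_into_equivclp exI[of _ "[]"])
    finally (equivclp_trans) show ?case by simp
  qed
  show "\<exists>h. equivclp cancel_pair (w @ h) [] \<and> equivclp cancel_pair (h @ w) []"
    using right[of w] right[of "rev w"] by (intro exI[of _ "rev w"]) simp
qed

section \<open>Reflections attached to a mutation sequence\<close>

text \<open>The order on vectors is componentwise, and \<open>0 < c\<close> means \<open>0 \<le> c\<close> and \<open>c \<noteq> 0\<close>.\<close>

function refl_elem :: "int^'n^'n \<Rightarrow> 'n list \<Rightarrow> 'n \<Rightarrow> 'n ucox" where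
  "refl_elem B [] i = gen i"
| "refl_elem B (w @ [k]) i =
     (if bmat B w $ i $ k *s cvec B w k > 0
      then refl_elem B w k * refl_elem B w i * refl_elem B w k
      else refl_elem B w i)"
  by (auto, metis rev_exhaust)
termination by (relation "measure (length \<circ> fst \<circ> snd)") auto

section \<open>The representation determined by a linear ordering\<close>

text \<open>\<open>prec\<close> is the set of pairs \<open>(i, j)\<close> with \<open>i \<prec> j\<close>.\<close>

definition gim :: "('n \<times> 'n) set \<Rightarrow> int^'n^'n \<Rightarrow> int^'n^'n" where
  "gim prec B = (\<chi> i j. if i = j then 2 else if (i, j) \<in> prec then B $ i $ j else - (B $ i $ j))"

text \<open>The lattice with basis \<open>\<alpha>\<^sub>j\<close> is \<open>int^'n\<close>, with \<open>\<alpha>\<^sub>j = axis j 1\<close>.\<close>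

definition gim_reflection :: "int^'n^'n \<Rightarrow> 'n \<Rightarrow> int^'n \<Rightarrow> int^'n" where
  "gim_reflection A i x = (\<Sum>j\<in>UNIV. x $ j *s (axis j 1 - A $ j $ i *s axis i 1))"

lemma gim_reflection_axis:
  "gim_reflection A i (axis j 1) = axis j 1 - A $ j $ i *s axis i 1"
  unfolding gim_reflection_def
  by (subst sum.mono_neutral_right[of UNIV "{j}"]) (auto simp: axis_def)

lemma gim_reflection_nth:
  "gim_reflection A i x $ l = x $ l - (if l = i then \<Sum>j\<in>UNIV. x $ j * A $ j $ i else 0)"
proof -
  have "gim_reflection A i x $ l =
      (\<Sum>j\<in>UNIV. (if j = l then x $ j else 0) - (if l = i then x $ j * A $ j $ i else 0))"
    unfolding gim_reflection_def sum_component
    by (rule sum.cong) (auto simp: axis_def algebra_simps)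
  then show ?thesis by (simp add: sum_subtractf)
qed

lemma gim_reflection_involution:
  assumes "A $ i $ i = 2"
  shows "gim_reflection A i (gim_reflection A i x) = x"
proof -
  let ?S = "\<Sum>j\<in>UNIV. x $ j * A $ j $ i"
  have "(\<Sum>j\<in>UNIV. gim_reflection A i x $ j * A $ j $ i) =
      (\<Sum>j\<in>UNIV. x $ j * A $ j $ i - (if j = i then ?S * A $ i $ i else 0))"
    by (auto simp: gim_reflection_nth algebra_simps intro!: sum.cong)
  also have "\<dots> = - ?S"
    using assms by (simp add: sum_subtractf)
  finally show ?thesis
    by (simp add: vec_eq_iff gim_reflection_nth)
qed

text \<open>\<open>\<pi>(s\<^sub>i\<^sub>1 \<cdots> s\<^sub>i\<^sub>l) = \<pi>(s\<^sub>i\<^sub>1) \<circ> \<cdots> \<circ> \<pi>(s\<^sub>i\<^sub>l)\<close>\<close>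

lift_definition gim_rep :: "('n::finite \<times> 'n) set \<Rightarrow> int^'n^'n \<Rightarrow> 'n ucox \<Rightarrow> int^'n \<Rightarrow> int^'n"
  is "\<lambda>prec B. foldr (gim_reflection (gim prec B))"
proof -
  fix prec and B :: "int^'n^'n" and x y :: "'n list"
  assume "equivclp cancel_pair x y"
  then show "foldr (gim_reflection (gim prec B)) x = foldr (gim_reflection (gim prec B)) y"
  proof (induction rule: equivclp_induct)
    case base
    show ?case by simp
  next
    case (step y z)
    have "foldr (gim_reflection (gim prec B)) a = foldr (gim_reflection (gim prec B)) b"
      if "cancel_pair a b" for a b
      using that unfolding cancel_pair_def
      by (auto simp: fun_eq_iff gim_reflection_involution gim_def)
    then show ?case using step by metis
  qed
qed

lemma gim_rep_gen: "gim_rep prec B (gen i) = gim_reflection (gim prec B) i"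
  by transfer (simp add: fun_eq_iff)

lemma gim_rep_one: "gim_rep prec B 1 = id"
  by transfer (simp add: fun_eq_iff)

lemma gim_rep_mult: "gim_rep prec B (g * h) = gim_rep prec B g \<circ> gim_rep prec B h"
  by transfer (simp add: fun_eq_iff)

section \<open>Pseudo-acyclic orderings\<close>

definition pseudo_acyclic_ordering :: "int^'n^'n \<Rightarrow> ('n \<times> 'n) set \<Rightarrow> bool" where
  "pseudo_acyclic_ordering B prec \<longleftrightarrow> strict_linear_order prec \<and>
     (\<forall>w v. cmat B w = cmat B v \<longrightarrow>
        (\<forall>i. gim_rep prec B (refl_elem B w i) = gim_rep prec B (refl_elem B v i)))"

end

theory Submission
  imports Defs
begin

text \<open>
  A type \<open>A\<close> quiver is the quiver of a triangulation of a polygon: its vertices are the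
  diagonals, its arrows join diagonals of a common triangle, and mutation is the flip of a
  diagonal.  For a suitable ordering the generalized intersection matrix of such a quiver is
  positive definite, and then the statement reduces to a congruence modulo 2.

  \<^bold>\<open>Reduction modulo 2.\<close>  Suppose that the symmetric form with matrix \<open>A\<close> is positive
  definite (it is even, since the diagonal entries are 2).  Then \<open>\<pi>(r\<^sub>i)\<close> is, for every mutation
  sequence, the reflection in a vector \<open>\<beta>\<^sub>i\<close> of square length 2.  Two vectors
  \<open>\<beta>\<close>, \<open>\<delta>\<close> of square length 2 that are congruent modulo 2 are equal up to sign:
  with \<open>u = (\<beta> + \<delta>) / 2\<close> and \<open>v = (\<beta> - \<delta>) / 2\<close> the square lengths of \<open>u\<close> and \<open>v\<close> are even,
  nonnegative and add up to 2, so one of them vanishes (lemma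
  \<open>root_reflection_cong_mod_2\<close>).  It remains to see that \<open>\<beta>\<^sub>i\<close> is congruent modulo 2 to the
  \<open>c\<close>-vector \<open>c\<^sub>i\<close>, so that equal \<open>C\<close>-matrices give equal reflections.  Together with
  the congruence of the inner products of \<open>\<beta>\<^sub>i\<close>, \<open>\<beta>\<^sub>j\<close> to \<open>b\<^sub>i\<^sub>j\<close> this follows by induction along the
  mutation sequence: modulo 2 the rules for \<open>\<beta>\<close>, \<open>c\<close> and \<open>b\<close> are the same
  (lemma \<open>reflections_of_roots\<close>), provided that each \<open>c\<close>-vector has a sign.

  \<^bold>\<open>Sign coherence.\<close>  Column \<open>l\<close> of the \<open>C\<close>-matrix consists of the shear coordinates of a
  lamination \<open>L\<^sub>l\<close>, obtained by turning the \<open>l\<close>-th diagonal of the initial triangulation slightly.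
  A positive and a negative entry in one row mean that two laminations cross the same
  quadrilateral through different pairs of opposite sides; such laminations cross each
  other, whereas the diagonals of the initial triangulation do not (lemma \<open>sign_coherence\<close>).

  \<^bold>\<open>Positivity.\<close>  Put the vertices of the polygon on a line.  Ordering the diagonals by
  decreasing right end and then by increasing left end makes the three sides of each triangle
  appear in the same rotational sense.  Then the quadratic form of the generalized
  intersection matrix is a sum of squares, one for each triangle, and the
  squares vanish together only at the origin (lemma \<open>triangulation_even_positive\<close>).
\<close>

section \<open>Triangulations and flips\<close>

text \<open>Polygon vertices are integers, thought of as placed on a circle in their natural order.
  Edges and diagonals are two-element sets.\<close>

definition cyclic4 :: "int \<Rightarrow> int \<Rightarrow> int \<Rightarrow> int \<Rightarrow> bool" where
  "cyclic4 p q r s \<longleftrightarrow>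
     p < q \<and> q < r \<and> r < s \<or> q < r \<and> r < s \<and> s < p \<or>
     r < s \<and> s < p \<and> p < q \<or> s < p \<and> p < q \<and> q < r"

text \<open>Two chords cross when their end points alternate on the circle.\<close>

definition noncrossing :: "int set set \<Rightarrow> bool" where
  "noncrossing E \<longleftrightarrow> (\<forall>p q r s. cyclic4 p q r s \<longrightarrow> {p, r} \<in> E \<longrightarrow> {q, s} \<notin> E)"

text \<open>The quadrilateral around the diagonal \<open>d\<close>; the diagonal joins the first vertex to the third,
  so the same quadrilateral is also listed as \<open>r s p q\<close>.\<close>

definition quad :: "int set set \<Rightarrow> int set \<Rightarrow> int \<Rightarrow> int \<Rightarrow> int \<Rightarrow> int \<Rightarrow> bool" where
  "quad E d p q r s \<longleftrightarrow> cyclic4 p q r s \<and> d = {p, r} \<and>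
     {p, q} \<in> E \<and> {q, r} \<in> E \<and> {r, s} \<in> E \<and> {s, p} \<in> E"

text \<open>The tropical cross-ratio of the quadrilateral.  It is used for two kinds of functions \<open>X\<close>: the
  indicator of a diagonal, where it counts arrows, and the function attached
  to a lamination, where it is the shear coordinate.\<close>

definition shear :: "(int set \<Rightarrow> int) \<Rightarrow> int \<Rightarrow> int \<Rightarrow> int \<Rightarrow> int \<Rightarrow> int" where
  "shear X p q r s = X {p, q} + X {r, s} - X {q, r} - X {s, p}"

text \<open>The relation between the values of \<open>X\<close> on the sides and diagonals of a quadrilateral that makes
  the cross-ratios of neighbouring diagonals transform by the mutation rule under a flip.\<close>

definition tropical_Pluecker :: "(int set \<Rightarrow> int) \<Rightarrow> int \<Rightarrow> int \<Rightarrow> int \<Rightarrow> int \<Rightarrow> bool" where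
  "tropical_Pluecker X p q r s \<longleftrightarrow>
     X {p, r} + X {q, s} = min (X {p, q} + X {r, s}) (X {q, r} + X {s, p})"

abbreviation edge_indicator :: "int set \<Rightarrow> int set \<Rightarrow> int" where
  "edge_indicator d \<equiv> \<lambda>e. of_bool (e = d)"

lemma cyclic4_rotate: "cyclic4 p q r s \<Longrightarrow> cyclic4 q r s p"
  unfolding cyclic4_def by blast

lemma cyclic4_distinct:
  "cyclic4 p q r s \<Longrightarrow> p \<noteq> q \<and> p \<noteq> r \<and> p \<noteq> s \<and> q \<noteq> r \<and> q \<noteq> s \<and> r \<noteq> s"
  unfolding cyclic4_def by (smt (verit))

lemma noncrossingD: "noncrossing E \<Longrightarrow> cyclic4 p q r s \<Longrightarrow> {p, r} \<in> E \<Longrightarrow> {q, s} \<in> E \<Longrightarrow> False"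
  unfolding noncrossing_def by blast

lemma quad_rotate: "quad E d p q r s \<Longrightarrow> quad E d r s p q"
  unfolding quad_def by (metis cyclic4_rotate insert_commute)

lemma shear_rotate: "shear X p q r s = shear X r s p q"
  unfolding shear_def by simp

lemma tropical_Pluecker_rotate: "tropical_Pluecker X p q r s \<Longrightarrow> tropical_Pluecker X r s p q"
  unfolding tropical_Pluecker_def by (simp add: insert_commute add.commute)

text \<open>Two candidates for the third vertex of a triangle on the same side of \<open>p r\<close> would give two
  crossing sides.  Hence the quadrilateral around a diagonal is determined, and with it
  every number read off from it.\<close>

lemma apex_unique:
  assumes "noncrossing E" "cyclic4 p q r s" "cyclic4 p q' r s"
    and "{p, q} \<in> E" "{q, r} \<in> E" "{p, q'} \<in> E" "{q', r} \<in> E"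
  shows "q = q'"
proof (rule ccontr)
  assume "q \<noteq> q'"
  then have "cyclic4 p q q' r \<or> cyclic4 p q' q r"
    using assms(2,3) unfolding cyclic4_def by (smt (verit))
  then show False
    using noncrossingD[OF assms(1)] assms(4-7) by blast
qed

lemma opposite_apex_unique:
  assumes "noncrossing E" "cyclic4 p q r s" "cyclic4 p q r s'"
    and "{r, s} \<in> E" "{s, p} \<in> E" "{r, s'} \<in> E" "{s', p} \<in> E"
  shows "s = s'"
  using apex_unique[of E r s p q s'] assms cyclic4_rotate by metis

lemma quad_unique:
  assumes E: "noncrossing E" and 1: "quad E d p q r s" and 2: "quad E d p' q' r' s'"
  shows "(p', q', r', s') = (p, q, r, s) \<or> (p', q', r', s') = (r, s, p, q)"
proof -
  have key: "q' = q \<and> s' = s" if 1: "quad E d p q r s" and 2: "quad E d p q' r s'"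
    for p q r s q' s'
  proof -
    have c: "cyclic4 p q r s" "cyclic4 p q' r s'"
      using 1 2 unfolding quad_def by auto
    then have c': "cyclic4 p q' r s"  "cyclic4 p q r s'"
      unfolding cyclic4_def by (smt (verit))+
    have "q = q'"
      using apex_unique[OF E c(1) c'(1)] 1 2 unfolding quad_def by blast
    moreover have "s = s'"
      using opposite_apex_unique[OF E c(1) c'(2)] 1 2 unfolding quad_def by blast
    ultimately show ?thesis by simp
  qed
  have "{p, r} = {p', r'}" using 1 2 unfolding quad_def by simp
  then consider "p' = p" "r' = r" | "p' = r" "r' = p" by (auto simp: doubleton_eq_iff)
  then show ?thesis
  proof cases
    case 1 then show ?thesis using key assms by metis
  next
    case 2 then show ?thesis using key quad_rotate assms by metis
  qed
qed

lemma shear_quad_unique: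
  assumes "noncrossing E" "quad E d p q r s" "quad E d p' q' r' s'"
  shows "shear X p' q' r' s' = shear X p q r s"
  using quad_unique[OF assms] shear_rotate[of X p q r s] by auto

definition flip :: "int set set \<Rightarrow> int \<Rightarrow> int \<Rightarrow> int \<Rightarrow> int \<Rightarrow> int set set" where
  "flip E p q r s = insert {q, s} (E - {{p, r}})"

lemma flip_rotate: "flip E p q r s = flip E r s p q"
  unfolding flip_def by (simp add: insert_commute)

lemma quad_diagonal: "noncrossing E \<Longrightarrow> quad E d p q r s \<Longrightarrow> d \<in> E \<Longrightarrow> {q, s} \<notin> E"
  unfolding quad_def using noncrossingD by blast

text \<open>A chord that crosses \<open>q s\<close> but none of the four sides has to leave the quadrilateral through
  the two remaining corners.\<close>

lemma crosses_other_diagonal: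
  assumes E: "noncrossing E" and Q: "quad E d p q r s"
    and "cyclic4 q x s y" "{x, y} \<in> E"
  shows "{x, y} = {p, r}"
proof -
  have c: "cyclic4 p q r s" and e: "{p, q} \<in> E" "{q, r} \<in> E" "{r, s} \<in> E" "{s, p} \<in> E"
    using Q unfolding quad_def by auto
  have "x = r"
  proof (rule ccontr)
    assume "x \<noteq> r"
    then have "cyclic4 q x r y \<or> cyclic4 r x s y"
      using c assms(3) unfolding cyclic4_def by (smt (verit))
    then show False using noncrossingD[OF E] e assms(4) by blast
  qed
  moreover have "y = p"
  proof (rule ccontr)
    assume "y \<noteq> p"
    then have "cyclic4 s y p x \<or> cyclic4 p y q x"
      using c assms(3) unfolding cyclic4_def by (smt (verit))
    then show False using noncrossingD[OF E] e assms(4) by (metis insert_commute)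
  qed
  ultimately show ?thesis by auto
qed

lemma noncrossing_flip:
  assumes E: "noncrossing E" and Q: "quad E d p q r s"
  shows "noncrossing (flip E p q r s)"
  unfolding noncrossing_def
proof (intro allI impI notI)
  fix a b c e
  assume c: "cyclic4 a b c e" and ac: "{a, c} \<in> flip E p q r s" and be: "{b, e} \<in> flip E p q r s"
  have no: False if xyzt: "cyclic4 x y z t" and xz: "{x, z} = {q, s}"
    and yt: "{y, t} \<in> E" "{y, t} \<noteq> {p, r}" for x y z t
  proof -
    consider "x = q" "z = s" | "x = s" "z = q" using xz by (metis doubleton_eq_iff)
    then have "cyclic4 q y s t \<or> cyclic4 q t s y"
      using xyzt cyclic4_rotate by cases blast+
    then show False
      using crosses_other_diagonal[OF E Q] yt by (metis insert_commute)
  qed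
  have ne: "{a, c} \<noteq> {b, e}" using cyclic4_distinct[OF c] by (auto simp: doubleton_eq_iff)
  show False
  proof (cases "{a, c} = {q, s}")
    case True
    then show False using no[OF c True] be ne unfolding flip_def by auto
  next
    case False
    show False
    proof (cases "{b, e} = {q, s}")
      case True
      then show False using no[OF cyclic4_rotate[OF c] True] ac ne unfolding flip_def
        by (auto simp: insert_commute)
    next
      case be': False
      then show False using noncrossingD[OF E c] ac be False unfolding flip_def by auto
    qed
  qed
qed

lemma quad_flip_self:
  assumes "quad E {p, r} p q r s"
  shows "quad (flip E p q r s) {q, s} q r s p"
proof -
  have c: "cyclic4 p q r s" using assms unfolding quad_def by auto
  show ?thesis
    using assms cyclic4_rotate[OF c] cyclic4_distinct[OF c]
    unfolding quad_def flip_def by (auto simp: doubleton_eq_iff)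
qed

text \<open>The flip of \<open>{p, r}\<close> replaces the quadrilateral \<open>a b c e\<close> around \<open>d\<close> by \<open>a' b' c' e'\<close>, and the
  cross-ratios change by the mutation rule.  Here
  \<open>shear (edge_indicator {p, r}) a b c e\<close> is the signed number of arrows from \<open>d\<close> to the
  flipped diagonal, and \<open>shear X p q r s\<close> is the cross-ratio at the flipped
  diagonal.\<close>

definition flips_to :: "int \<Rightarrow> int \<Rightarrow> int \<Rightarrow> int \<Rightarrow> int set set \<Rightarrow> int set \<Rightarrow> int \<Rightarrow> int \<Rightarrow> int \<Rightarrow> int \<Rightarrow>
    int \<Rightarrow> int \<Rightarrow> int \<Rightarrow> int \<Rightarrow> bool" where
  "flips_to p q r s E d a b c e a' b' c' e' \<longleftrightarrow>
     quad (flip E p q r s) d a' b' c' e' \<and>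
     shear (edge_indicator {q, s}) a' b' c' e' = - shear (edge_indicator {p, r}) a b c e \<and>
     (\<forall>X. tropical_Pluecker X p q r s \<longrightarrow>
        shear X a' b' c' e' = shear X a b c e +
          sgn (shear (edge_indicator {p, r}) a b c e) *
          max (shear (edge_indicator {p, r}) a b c e * shear X p q r s) 0)"

lemma flips_to_rotate_diagonal:
  "flips_to r s p q E d a b c e a' b' c' e' \<Longrightarrow> flips_to p q r s E d a b c e a' b' c' e'"
  unfolding flips_to_def flip_rotate[of E r s p q] shear_rotate[of _ r s p q]
    insert_commute[of s q "{}"] insert_commute[of r p "{}"]
  using tropical_Pluecker_rotate by blast

lemma flips_to_rotate_quad:
  "flips_to p q r s E d c e a b a' b' c' e' \<Longrightarrow> flips_to p q r s E d a b c e a' b' c' e'"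
  unfolding flips_to_def using shear_rotate[of _ a b c e] by metis

text \<open>The diagonal \<open>d\<close> and the flipped diagonal \<open>{p, r}\<close> are sides of a common triangle, which
  must be the triangle \<open>p r s\<close>; so \<open>d = {p, s}\<close>, and after the flip the triangle \<open>p q s\<close>
  takes its place.  Inserting the tropical Pluecker relation, the change of the cross-ratio
  is \<open>max (shear X p q r s) 0\<close>.\<close>

lemma flips_to_across_first_side:
  assumes E: "noncrossing E" and Q: "quad E {p, r} p q r s" and R: "quad E d p r c e" and d: "d \<in> E"
  shows "flips_to p q r s E d p r c e p q c e"
proof -
  have cyc: "cyclic4 p q r s" "cyclic4 p r c e" using Q R unfolding quad_def by auto
  then have cyc': "cyclic4 p q r c" unfolding cyclic4_def by (smt (verit))
  have c: "c = s"
    using opposite_apex_unique[OF E cyc' cyc(1)] Q R d unfolding quad_def by (auto simp: insert_commute)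
  note R = R[unfolded c]
  have pqse: "cyclic4 p q s e" using cyc c unfolding cyclic4_def by (smt (verit))
  then have "quad (flip E p q r s) d p q s e"
    using Q R pqse cyclic4_distinct[OF cyc(2)[unfolded c]] cyclic4_distinct[OF cyc(1)] cyclic4_distinct[OF pqse]
    unfolding quad_def flip_def by (simp add: doubleton_eq_iff) metis
  moreover have "shear (edge_indicator {p, r}) p r s e = 1"
    "shear (edge_indicator {q, s}) p q s e = -1"
    using cyclic4_distinct[OF cyc(2)[unfolded c]] cyclic4_distinct[OF cyc(1)] cyclic4_distinct[OF pqse]
    unfolding shear_def by (simp_all add: doubleton_eq_iff) metis+
  moreover have "shear X p q s e = shear X p r s e + max (shear X p q r s) 0"
    if "tropical_Pluecker X p q r s" for X
    using that unfolding shear_def tropical_Pluecker_def by linarith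
  ultimately show ?thesis
    unfolding flips_to_def c by simp
qed

text \<open>The mirror situation, with \<open>d = {s, r}\<close> and the arrow reversed.\<close>

lemma flips_to_across_second_side:
  assumes E: "noncrossing E" and Q: "quad E {p, r} p q r s" and R: "quad E d a p r e" and d: "d \<in> E"
  shows "flips_to p q r s E d a p r e a q r e"
proof -
  have cyc: "cyclic4 p q r s" "cyclic4 a p r e" using Q R unfolding quad_def by auto
  then have cyc': "cyclic4 p q r a" unfolding cyclic4_def by (smt (verit))
  have c: "a = s"
    using opposite_apex_unique[OF E cyc' cyc(1)] Q R d unfolding quad_def by (auto simp: insert_commute)
  note R = R[unfolded c]
  have sqre: "cyclic4 s q r e" using cyc c unfolding cyclic4_def by (smt (verit))
  then have "quad (flip E p q r s) d s q r e"
    using Q R sqre cyclic4_distinct[OF cyc(2)[unfolded c]] cyclic4_distinct[OF cyc(1)] cyclic4_distinct[OF sqre]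
    unfolding quad_def flip_def by (simp add: doubleton_eq_iff) metis
  moreover have "shear (edge_indicator {p, r}) s p r e = -1"
    "shear (edge_indicator {q, s}) s q r e = 1"
    using cyclic4_distinct[OF cyc(2)[unfolded c]] cyclic4_distinct[OF cyc(1)] cyclic4_distinct[OF sqre]
    unfolding shear_def by (simp_all add: doubleton_eq_iff) metis+
  moreover have "shear X s q r e = shear X s p r e - max (- shear X p q r s) 0"
    if "tropical_Pluecker X p q r s" for X
    using that
    unfolding shear_def tropical_Pluecker_def insert_commute[of s q "{}"] by linarith
  ultimately show ?thesis
    unfolding flips_to_def c by simp
qed

text \<open>Up to listing the two quadrilaterals from the other end, \<open>{p, r}\<close> is the first or the second
  side of the quadrilateral around \<open>d\<close>, or it is no side at all; in the last case nothing
  changes.\<close>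

lemma flips_to_exists:
  assumes E: "noncrossing E" and Q: "quad E {p, r} p q r s" and R: "quad E d a b c e"
    and pr: "{p, r} \<in> E" and d: "d \<in> E"
  shows "\<exists>a' b' c' e'. flips_to p q r s E d a b c e a' b' c' e'"
proof -
  have side1: "\<exists>a' b' c' e'. flips_to p q r s E d a b c e a' b' c' e'"
    if R: "quad E d a b c e" and side: "{a, b} = {p, r}" for a b c e
  proof -
    consider "a = p" "b = r" | "a = r" "b = p" using side by (auto simp: doubleton_eq_iff)
    then show ?thesis
    proof cases
      case 1
      then show ?thesis using flips_to_across_first_side[OF E Q] R d by blast
    next
      case 2
      then show ?thesis
        using flips_to_across_first_side[OF E, of r p s q] quad_rotate[OF Q] R d flips_to_rotate_diagonal
        by (metis insert_commute)
    qed
  qed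
  have side2: "\<exists>a' b' c' e'. flips_to p q r s E d a b c e a' b' c' e'"
    if R: "quad E d a b c e" and side: "{b, c} = {p, r}" for a b c e
  proof -
    consider "b = p" "c = r" | "b = r" "c = p" using side by (auto simp: doubleton_eq_iff)
    then show ?thesis
    proof cases
      case 1
      then show ?thesis using flips_to_across_second_side[OF E Q] R d by blast
    next
      case 2
      then show ?thesis
        using flips_to_across_second_side[OF E, of r p s q] quad_rotate[OF Q] R d flips_to_rotate_diagonal
        by (metis insert_commute)
    qed
  qed
  consider "{a, b} = {p, r}" | "{b, c} = {p, r}" | "{c, e} = {p, r}" | "{e, a} = {p, r}"
    | (none) "{a, b} \<noteq> {p, r}" "{b, c} \<noteq> {p, r}" "{c, e} \<noteq> {p, r}" "{e, a} \<noteq> {p, r}"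
    by blast
  then show ?thesis
  proof cases
    case none
    have qs: "{q, s} \<notin> E" using quad_diagonal[OF E Q pr] .
    then have "{a, b} \<noteq> {q, s}" "{b, c} \<noteq> {q, s}" "{c, e} \<noteq> {q, s}" "{e, a} \<noteq> {q, s}"
      using R unfolding quad_def by metis+
    then have "shear (edge_indicator {q, s}) a b c e = 0"
      unfolding shear_def by simp
    moreover have "shear (edge_indicator {p, r}) a b c e = 0"
      using none unfolding shear_def by simp
    moreover have "quad (flip E p q r s) d a b c e"
      using none R unfolding quad_def flip_def by simp
    ultimately have "flips_to p q r s E d a b c e a b c e"
      unfolding flips_to_def by simp
    then show ?thesis by blast
  next
    case 1 then show ?thesis using side1 R by blast
  next
    case 2 then show ?thesis using side2 R by blast
  next
    case 3 then show ?thesis using side1[OF quad_rotate[OF R]] flips_to_rotate_quad by blast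
  next
    case 4 then show ?thesis using side2[OF quad_rotate[OF R]] flips_to_rotate_quad by blast
  qed
qed

section \<open>Flips are mutations\<close>

text \<open>\<open>F\<close> is the set of sides of the polygon, which are never flipped, and \<open>D\<close> names the diagonals by
  the vertices of the quiver.  Maximality is expressed by the quadrilateral around each diagonal.\<close>

definition triangulation :: "int set set \<Rightarrow> ('n \<Rightarrow> int set) \<Rightarrow> bool" where
  "triangulation F D \<longleftrightarrow> inj D \<and> range D \<inter> F = {} \<and> noncrossing (F \<union> range D) \<and>
     (\<forall>k. \<exists>p q r s. quad (F \<union> range D) (D k) p q r s)"

text \<open>The entries of \<open>v\<close> are the cross-ratios of \<open>X\<close> at the diagonals; such vectors will be columns of
  the matrices \<open>B\<close> and \<open>C\<close>.\<close>

definition shears :: "int set set \<Rightarrow> ('n \<Rightarrow> int set) \<Rightarrow> (int set \<Rightarrow> int) \<Rightarrow> ('n \<Rightarrow> int) \<Rightarrow> bool" where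
  "shears F D X v \<longleftrightarrow>
     (\<forall>i p q r s. quad (F \<union> range D) (D i) p q r s \<longrightarrow> v i = shear X p q r s)"

text \<open>With the sign convention of \<open>shear\<close> there is an arrow from the diagonal \<open>{p, r}\<close> of \<open>p q r s\<close> to
  the sides \<open>{p, q}\<close> and \<open>{r, s}\<close>, and one to it from the other two sides.\<close>

definition triangulation_of :: "int set set \<Rightarrow> ('n \<Rightarrow> int set) \<Rightarrow> int^'n^'n \<Rightarrow> bool" where
  "triangulation_of F D B \<longleftrightarrow> triangulation F D \<and>
     (\<forall>j. shears F D (edge_indicator (D j)) (\<lambda>i. B $ i $ j))"

lemma shearsI:
  assumes "noncrossing (F \<union> range D)"
    and "\<And>i. \<exists>p q r s. quad (F \<union> range D) (D i) p q r s \<and> v i = shear X p q r s"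
  shows "shears F D X v"
  unfolding shears_def using assms shear_quad_unique by metis

lemma mutate_nth:
  "mutate k M $ i $ j = (if i = k \<or> j = Inl k then - (M $ i $ j)
     else M $ i $ j + sgn (M $ i $ Inl k) * max (M $ i $ Inl k * M $ k $ j) 0)"
  by (simp add: mutate_def)

lemma bmat_snoc:
  "bmat B (w @ [k]) $ i $ j = (if i = k \<or> j = k then - (bmat B w $ i $ j)
     else bmat B w $ i $ j + sgn (bmat B w $ i $ k) * max (bmat B w $ i $ k * bmat B w $ k $ j) 0)"
  by (simp add: bmat_def mutate_nth)

lemma cmat_snoc:
  "cmat B (w @ [k]) $ i $ j = (if i = k then - (cmat B w $ i $ j)
     else cmat B w $ i $ j + sgn (bmat B w $ i $ k) * max (bmat B w $ i $ k * cmat B w $ k $ j) 0)"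
  by (simp add: bmat_def cmat_def mutate_nth)

lemma bmat_Nil: "bmat B [] = B" and cmat_Nil: "cmat B [] = mat 1"
  by (simp_all add: bmat_def cmat_def framed_def vec_eq_iff)

text \<open>One flip serves all columns at once: the \<open>B\<close>-columns, and every column of cross-ratios of a
  function \<open>X\<close> with the tropical Pluecker relation.  The latter will be used for the
  columns of the \<open>C\<close>-matrix.\<close>

lemma flip_mutates:
  fixes D :: "'n::finite \<Rightarrow> int set"
  assumes T: "triangulation_of F D (bmat B w)"
  shows "\<exists>D'. triangulation_of F D' (bmat B (w @ [k])) \<and>
    (\<forall>X v. shears F D X v \<longrightarrow> (\<forall>p q r s. cyclic4 p q r s \<longrightarrow> tropical_Pluecker X p q r s) \<longrightarrow>
      shears F D' X (\<lambda>i. if i = k then - v i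
        else v i + sgn (bmat B w $ i $ k) * max (bmat B w $ i $ k * v k) 0))"
proof -
  let ?E = "F \<union> range D"
  let ?b = "bmat B w"
  have inj: "inj D" and FD: "range D \<inter> F = {}" and E: "noncrossing ?E"
    and quads: "\<And>k. \<exists>p q r s. quad ?E (D k) p q r s"
    and b: "\<And>j. shears F D (edge_indicator (D j)) (\<lambda>i. ?b $ i $ j)"
    using T unfolding triangulation_of_def triangulation_def by auto
  obtain p q r s where Qk: "quad ?E (D k) p q r s" using quads by blast
  then have Dk: "D k = {p, r}" and c: "cyclic4 p q r s" unfolding quad_def by auto
  have Q: "quad ?E {p, r} p q r s" using Qk Dk by simp
  have prE: "{p, r} \<in> ?E" using Dk by auto
  have qs: "{q, s} \<notin> ?E" using quad_diagonal[OF E Q prE] .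
  define D' where "D' = D(k := {q, s})"
  have E': "F \<union> range D' = flip ?E p q r s"
  proof -
    have "D i \<noteq> D k" if "i \<noteq> k" for i using inj that by (simp add: inj_eq)
    then show ?thesis
      using FD Dk unfolding D'_def flip_def by (auto simp: image_iff)
  qed
  have inj': "inj D'"
    using inj qs unfolding D'_def inj_def by auto
  have FD': "range D' \<inter> F = {}"
    using FD qs unfolding D'_def by auto
  have nc': "noncrossing (F \<union> range D')"
    unfolding E' by (rule noncrossing_flip[OF E Q])
  have self: "quad (F \<union> range D') (D' k) q r s p"
    using quad_flip_self[OF Q] unfolding E' by (simp add: D'_def)
  have nb: "\<exists>a b c e a' b' c' e'. quad ?E (D i) a b c e \<and>
      quad (F \<union> range D') (D' i) a' b' c' e' \<and> flips_to p q r s ?E (D i) a b c e a' b' c' e'"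
    if "i \<noteq> k" for i
  proof -
    obtain a b c e where R: "quad ?E (D i) a b c e" using quads by blast
    then obtain a' b' c' e' where fl: "flips_to p q r s ?E (D i) a b c e a' b' c' e'"
      using flips_to_exists[OF E Q R prE] by auto
    have "D' i = D i" using that by (simp add: D'_def)
    then have "quad (F \<union> range D') (D' i) a' b' c' e'"
      using fl unfolding flips_to_def E' by simp
    then show ?thesis using R fl by blast
  qed
  have tri': "triangulation F D'"
    unfolding triangulation_def using inj' FD' nc' self nb by metis
  have col: "?b $ i $ k = shear (edge_indicator {p, r}) a b c e" if "quad ?E (D i) a b c e" for i a b c e
    using b[of k] that Dk unfolding shears_def by simp
  have step: "shears F D' X (\<lambda>i. if i = k then - v i
        else v i + sgn (?b $ i $ k) * max (?b $ i $ k * v k) 0)"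
    if v: "shears F D X v" and P: "tropical_Pluecker X p q r s" for X v
  proof (rule shearsI[OF nc'])
    fix i
    have vk: "v k = shear X p q r s" using v Qk unfolding shears_def by blast
    show "\<exists>a b c e. quad (F \<union> range D') (D' i) a b c e \<and>
      (if i = k then - v i else v i + sgn (?b $ i $ k) * max (?b $ i $ k * v k) 0) = shear X a b c e"
    proof (cases "i = k")
      case True
      then show ?thesis
        using self vk unfolding shear_def by (intro exI[of _ q] exI[of _ r] exI[of _ s] exI[of _ p]) simp
    next
      case False
      then obtain a b c e a' b' c' e' where R: "quad ?E (D i) a b c e"
        and R': "quad (F \<union> range D') (D' i) a' b' c' e'"
        and fl: "flips_to p q r s ?E (D i) a b c e a' b' c' e'"
        using nb by blast
      have "v i = shear X a b c e" using v R unfolding shears_def by blast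
      then have "v i + sgn (?b $ i $ k) * max (?b $ i $ k * v k) 0 = shear X a' b' c' e'"
        using fl P col[OF R] vk unfolding flips_to_def by simp
      then show ?thesis using False R' by auto
    qed
  qed
  have "triangulation_of F D' (bmat B (w @ [k]))"
    unfolding triangulation_of_def
  proof (intro conjI allI tri')
    fix j
    show "shears F D' (edge_indicator (D' j)) (\<lambda>i. bmat B (w @ [k]) $ i $ j)"
    proof (cases "j = k")
      case False
      then have Dj: "D' j = D j" "D j \<in> ?E" "D j \<noteq> {p, r}" "D j \<noteq> {q, s}"
        using injD[OF inj, of j k] Dk qs unfolding D'_def by auto
      \<comment> \<open>Both diagonals of the quadrilateral have indicator 0, and at most one side is \<open>D j\<close>.\<close>
      have "tropical_Pluecker (edge_indicator (D j)) p q r s"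
        using Dj cyclic4_distinct[OF c] unfolding tropical_Pluecker_def
        by (auto simp: doubleton_eq_iff)
      from step[OF b this] show ?thesis
        using False by (simp add: bmat_snoc Dj cong: if_cong)
    next
      case True
      show ?thesis
      proof (rule shearsI[OF nc'])
        fix i
        show "\<exists>a b c e. quad (F \<union> range D') (D' i) a b c e \<and>
           bmat B (w @ [k]) $ i $ j = shear (edge_indicator (D' j)) a b c e"
        proof (cases "i = k")
          case i: True
          have "shear (edge_indicator {p, r}) p q r s = 0" "shear (edge_indicator {q, s}) q r s p = 0"
            using cyclic4_distinct[OF c] unfolding shear_def by (auto simp: doubleton_eq_iff)
          then show ?thesis using self col[OF Qk] i True
            by (intro exI[of _ q] exI[of _ r] exI[of _ s] exI[of _ p]) (simp add: bmat_snoc D'_def)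
        next
          case i: False
          then obtain a b c e a' b' c' e' where R: "quad ?E (D i) a b c e"
            and R': "quad (F \<union> range D') (D' i) a' b' c' e'"
            and fl: "flips_to p q r s ?E (D i) a b c e a' b' c' e'"
            using nb by blast
          have "bmat B (w @ [k]) $ i $ j = shear (edge_indicator (D' j)) a' b' c' e'"
            using fl col[OF R] True unfolding flips_to_def by (simp add: bmat_snoc D'_def)
          then show ?thesis using R' by blast
        qed
      qed
    qed
  qed
  then show ?thesis using step c by blast
qed

section \<open>Sign coherence of c-vectors\<close>

text \<open>A lamination cuts off a set \<open>I\<close> of consecutive vertices.  Up to a factor 2 and terms that cancel
  in every cross-ratio, \<open>inside I\<close> is the indicator of the chords that the lamination does not
  cross; this normalisation makes the shear coordinates 0, 1 and -1.\<close>

abbreviation inside :: "int set \<Rightarrow> int set \<Rightarrow> int" where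
  "inside I \<equiv> \<lambda>e. of_bool (e \<subseteq> I)"

lemma shear_inside:
  "shear (inside I) p q r s =
     (of_bool (p \<in> I) - of_bool (r \<in> I)) * (of_bool (q \<in> I) - of_bool (s \<in> I))"
  unfolding shear_def by auto

text \<open>The only obstruction would be that \<open>I\<close> separates \<open>p, r\<close> from \<open>q, s\<close>, which an interval cannot
  do.\<close>

lemma tropical_Pluecker_inside:
  assumes "cyclic4 p q r s"
  shows "tropical_Pluecker (inside {a..<b}) p q r s"
proof -
  let ?I = "{a..<b}"
  have "\<not> (p \<in> ?I \<and> r \<in> ?I \<and> q \<notin> ?I \<and> s \<notin> ?I)" "\<not> (q \<in> ?I \<and> s \<in> ?I \<and> p \<notin> ?I \<and> r \<notin> ?I)"
    using assms unfolding cyclic4_def atLeastLessThan_iff by (smt (verit))+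
  then show ?thesis
    unfolding tropical_Pluecker_def by (auto simp del: atLeastLessThan_iff)
qed

text \<open>If the first interval separates \<open>p, q\<close> from \<open>r, s\<close> and the second separates \<open>p, s\<close> from \<open>q, r\<close>, the
  corners show that the intervals overlap without being nested, so their end points alternate.\<close>

lemma shear_inside_opposite:
  assumes E: "noncrossing E" and e: "{a, b} \<in> E" "{c, d} \<in> E" "a < b" "c < d"
    and pos: "shear (inside {a..<b}) p q r s > 0"
    and neg: "shear (inside {c..<d}) p q r s < 0"
  shows False
proof -
  let ?I = "{a..<b}" and ?J = "{c..<d}"
  have "(p \<in> ?I) = (q \<in> ?I)" "(r \<in> ?I) = (s \<in> ?I)" "(p \<in> ?I) \<noteq> (r \<in> ?I)"
    using pos unfolding shear_inside
    by (auto simp del: atLeastLessThan_iff simp: zero_less_mult_iff split: if_splits)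
  moreover have "(p \<in> ?J) = (s \<in> ?J)" "(q \<in> ?J) = (r \<in> ?J)" "(p \<in> ?J) \<noteq> (r \<in> ?J)"
    using neg unfolding shear_inside
    by (auto simp del: atLeastLessThan_iff simp: mult_less_0_iff split: if_splits)
  ultimately have "\<exists>x. x \<in> ?I \<and> x \<in> ?J" "\<exists>x. x \<in> ?I \<and> x \<notin> ?J" "\<exists>x. x \<notin> ?I \<and> x \<in> ?J"
    by metis+
  then have "a < c \<and> c < b \<and> b < d \<or> c < a \<and> a < d \<and> d < b"
    by auto
  then have "cyclic4 a c b d \<or> cyclic4 c a d b"
    unfolding cyclic4_def by blast
  then show False
    using noncrossingD[OF E] e by blast
qed

text \<open>The half-open interval between the ends of a diagonal is the lamination obtained by turning the
  diagonal slightly: it contains one end but not the other.  At its own quadrilateral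
  it separates \<open>p, q\<close> from \<open>r, s\<close>.  Any other quadrilateral lies on one side of the diagonal, so
  the lamination separates at most one of its corners from the others, which contributes nothing.  Thus the
  laminations of the initial triangulation give the identity matrix.\<close>

lemma shear_inside_initial:
  assumes T: "triangulation F D" and Dj: "D j = {a, b}" "a < b"
    and Q: "quad (F \<union> range D) (D i) p q r s"
  shows "shear (inside {a..<b}) p q r s = of_bool (i = j)"
proof (cases "i = j")
  case True
  have c: "cyclic4 p q r s" and "{p, r} = {a, b}" using Q Dj True unfolding quad_def by auto
  then consider "p = a" "r = b" | "p = b" "r = a" by (auto simp: doubleton_eq_iff)
  then show ?thesis
  proof cases
    case 1
    then have "a < q" "q < b" "s < a \<or> b < s" using c Dj(2) unfolding cyclic4_def by (smt (verit))+
    then show ?thesis using 1 Dj(2) True unfolding shear_inside by auto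
  next
    case 2
    then have "a < s" "s < b" "q < a \<or> b < q" using c Dj(2) unfolding cyclic4_def by (smt (verit))+
    then show ?thesis using 2 Dj(2) True unfolding shear_inside by auto
  qed
next
  case False
  let ?E = "F \<union> range D"
  have E: "noncrossing ?E" and inj: "inj D" using T unfolding triangulation_def by auto
  have ab: "{a, b} \<in> ?E" using Dj by (metis UnI2 rangeI)
  have side: "(a < x \<and> x < b \<longrightarrow> a \<le> y \<and> y \<le> b) \<and> (a < y \<and> y < b \<longrightarrow> a \<le> x \<and> x \<le> b)"
    if "{x, y} \<in> ?E" for x y
  proof (rule ccontr)
    assume "\<not> ?thesis"
    then have "cyclic4 a x b y \<or> cyclic4 a y b x"
      using Dj(2) unfolding cyclic4_def by (smt (verit))
    then show False using noncrossingD[OF E _ ab] that by (metis insert_commute)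
  qed
  have c: "cyclic4 p q r s" and Di: "D i = {p, r}" and e: "{p, q} \<in> ?E" "{q, r} \<in> ?E"
    "{r, s} \<in> ?E" "{s, p} \<in> ?E"
    using Q unfolding quad_def by auto
  have pr: "{p, r} \<in> ?E" using Di by (metis UnI2 rangeI)
  have ne: "{p, r} \<noteq> {a, b}" using False inj Di Dj by (metis inj_eq)
  have d: "p \<noteq> q" "p \<noteq> r" "p \<noteq> s" "q \<noteq> r" "q \<noteq> s" "r \<noteq> s" using cyclic4_distinct[OF c] by auto
  note sides = side[OF e(1)] side[OF e(2)] side[OF e(3)] side[OF e(4)] side[OF pr]
  have "(\<forall>x\<in>{p, q, r, s}. a \<le> x \<and> x \<le> b) \<or> (\<forall>x\<in>{p, q, r, s}. x \<le> a \<or> b \<le> x)"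
    using sides ne d Dj(2) by (simp add: doubleton_eq_iff) (smt (verit))
  then show ?thesis
  proof
    assume inn: "\<forall>x\<in>{p, q, r, s}. a \<le> x \<and> x \<le> b"
    then have "x \<in> {a..<b} \<longleftrightarrow> x \<noteq> b" if "x \<in> {p, q, r, s}" for x using that by force
    then show ?thesis using d False unfolding shear_inside
      by (auto simp del: atLeastLessThan_iff)
  next
    assume out: "\<forall>x\<in>{p, q, r, s}. x \<le> a \<or> b \<le> x"
    then have "x \<in> {a..<b} \<longleftrightarrow> x = a" if "x \<in> {p, q, r, s}" for x using that Dj(2) by force
    then show ?thesis using d False unfolding shear_inside
      by (auto simp del: atLeastLessThan_iff)
  qed
qed

lemma triangulation_diagonal:
  assumes "triangulation F D"
  obtains a b where "\<And>j. D j = {a j, b j}" "\<And>j. a j < b j"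
proof -
  have "\<exists>a b. D j = {a, b} \<and> a < b" for j
  proof -
    obtain p q r s where "quad (F \<union> range D) (D j) p q r s"
      using assms unfolding triangulation_def by blast
    then have "D j = {p, r}" "p \<noteq> r" unfolding quad_def using cyclic4_distinct by auto
    then show ?thesis by (metis insert_commute linorder_neqE)
  qed
  then show ?thesis using that by metis
qed

text \<open>Along the mutation sequence the quadrilaterals change but the laminations stay those of
  the initial triangulation.\<close>

lemma sign_coherence:
  fixes B :: "int^'n^'n"
  assumes T: "triangulation_of F D B"
  shows "(\<forall>l. cmat B w $ k $ l \<ge> 0) \<or> (\<forall>l. cmat B w $ k $ l \<le> 0)"
proof -
  have T0: "triangulation F D" using T unfolding triangulation_of_def by simp
  then have E: "noncrossing (F \<union> range D)" unfolding triangulation_def by simp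
  obtain a b where D: "\<And>j. D j = {a j, b j}" and ab: "\<And>j. a j < b j"
    using triangulation_diagonal[OF T0] by metis
  have "\<exists>D'. triangulation_of F D' (bmat B w) \<and>
     (\<forall>l. shears F D' (inside {a l..<b l}) (\<lambda>i. cmat B w $ i $ l))"
  proof (induction w rule: rev_induct)
    case Nil
    have "shears F D (inside {a l..<b l}) (\<lambda>i. cmat B [] $ i $ l)" for l
      unfolding shears_def
      using shear_inside_initial[OF T0 D[of l] ab[of l]] by (auto simp: cmat_Nil mat_def)
    then show ?case using T by (auto simp: bmat_Nil)
  next
    case (snoc k w)
    then obtain D1 where D1: "triangulation_of F D1 (bmat B w)"
      and c: "\<And>l. shears F D1 (inside {a l..<b l}) (\<lambda>i. cmat B w $ i $ l)"
      by blast
    obtain D2 where D2: "triangulation_of F D2 (bmat B (w @ [k]))"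
      and step: "\<forall>X v. shears F D1 X v \<longrightarrow>
        (\<forall>p q r s. cyclic4 p q r s \<longrightarrow> tropical_Pluecker X p q r s) \<longrightarrow>
        shears F D2 X (\<lambda>i. if i = k then - v i
          else v i + sgn (bmat B w $ i $ k) * max (bmat B w $ i $ k * v k) 0)"
      using flip_mutates[OF D1] by blast
    have "shears F D2 (inside {a l..<b l}) (\<lambda>i. cmat B (w @ [k]) $ i $ l)" for l
      using step[rule_format, OF c[of l] tropical_Pluecker_inside] by (simp add: cmat_snoc)
    then show ?case using D2 by blast
  qed
  then obtain D' where T': "triangulation_of F D' (bmat B w)"
    and c: "\<And>l. shears F D' (inside {a l..<b l}) (\<lambda>i. cmat B w $ i $ l)"
    by blast
  obtain p q r s where Q: "quad (F \<union> range D') (D' k) p q r s"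
    using T' unfolding triangulation_of_def triangulation_def by blast
  have c': "cmat B w $ k $ l = shear (inside {a l..<b l}) p q r s" for l
    using c Q unfolding shears_def by blast
  have "{a l, b l} \<in> F \<union> range D" for l using D by (metis UnI2 rangeI)
  then have "\<not> (cmat B w $ k $ l > 0 \<and> cmat B w $ k $ m < 0)" for l m
    using shear_inside_opposite[OF E _ _ ab ab, of l m] unfolding c' by blast
  then show ?thesis by (meson linorder_not_less)
qed

section \<open>Type A quivers come from triangulations\<close>

text \<open>A path quiver is the quiver of a triangulation by nested diagonals: each diagonal is obtained
  from the preceding one by moving its left end (if \<open>L\<close> holds) or its right end one step outwards.
  Index 0 and the index after the last vertex of the path belong to sides of the polygon.\<close>

primrec nested_lo :: "(nat \<Rightarrow> bool) \<Rightarrow> nat \<Rightarrow> int" where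
  "nested_lo L 0 = 0"
| "nested_lo L (Suc p) = nested_lo L p - (if L p then 1 else 0)"

primrec nested_hi :: "(nat \<Rightarrow> bool) \<Rightarrow> nat \<Rightarrow> int" where
  "nested_hi L 0 = 1"
| "nested_hi L (Suc p) = nested_hi L p + (if L p then 0 else 1)"

lemma nested_width: "nested_hi L p = nested_lo L p + int p + 1"
  by (induction p) auto

lemma nested_mono:
  "p \<le> q \<Longrightarrow> nested_lo L q \<le> nested_lo L p \<and> nested_hi L p \<le> nested_hi L q"
  by (induction q rule: dec_induct) auto

definition nested :: "(nat \<Rightarrow> bool) \<Rightarrow> nat \<Rightarrow> int set" where
  "nested L p = {nested_lo L p, nested_hi L p}"

lemma nested_inj: "nested L p = nested L q \<longleftrightarrow> p = q"
  using nested_width[of L p] nested_width[of L q] by (auto simp: nested_def doubleton_eq_iff)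

lemma nested_noncrossing:
  assumes "cyclic4 p q r s" "nested L m = {p, r}" "nested L m' = {q, s}"
  shows False
proof -
  have "p = nested_lo L m \<and> r = nested_hi L m \<or> r = nested_lo L m \<and> p = nested_hi L m"
    "q = nested_lo L m' \<and> s = nested_hi L m' \<or> s = nested_lo L m' \<and> q = nested_hi L m'"
    using assms(2,3) unfolding nested_def doubleton_eq_iff by metis+
  moreover have "nested_lo L m' \<le> nested_lo L m \<and> nested_hi L m \<le> nested_hi L m' \<or>
      nested_lo L m \<le> nested_lo L m' \<and> nested_hi L m' \<le> nested_hi L m"
    using nested_mono by (metis linear)
  moreover have "nested_lo L m < nested_hi L m" "nested_lo L m' < nested_hi L m'"
    using nested_width[of L m] nested_width[of L m'] by linarith+
  ultimately show False
    using assms(1) unfolding cyclic4_def by (smt (verit))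
qed

lemma unit_edge_noncrossing:
  assumes "cyclic4 p q r s" "{x, x + 1} = {p, r}"
  shows False
proof -
  have "p = x \<and> r = x + 1 \<or> r = x \<and> p = x + 1"
    using assms(2) unfolding doubleton_eq_iff by metis
  then show False using assms(1) unfolding cyclic4_def by (smt (verit))
qed

lemma quiver_antisym:
  assumes "quiver B"
  shows "B $ i $ j = - B $ j $ i"
proof -
  have "transpose B $ j $ i = (- B) $ j $ i" using assms unfolding quiver_def by simp
  then show ?thesis by (simp add: transpose_def)
qed

lemma path_triangulation:
  fixes B :: "int^'n^'n"
  assumes "dynkin_A_orientation B"
  shows "\<exists>F D. triangulation_of F D B"
proof -
  let ?N = "CARD('n)"
  have skew: "quiver B" using assms unfolding dynkin_A_orientation_def by simp
  have "\<exists>f. bij_betw f {1..?N} (UNIV :: 'n set) \<and> (\<forall>p\<in>{1..?N}. \<forall>q\<in>{1..?N}.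
      \<bar>B $ f p $ f q\<bar> = (if q = p + 1 \<or> p = q + 1 then 1 else 0))"
    using assms unfolding dynkin_A_orientation_def by (rule conjunct2)
  then obtain f where f: "bij_betw f {1..?N} (UNIV :: 'n set)"
    and path: "\<forall>p\<in>{1..?N}. \<forall>q\<in>{1..?N}.
      \<bar>B $ f p $ f q\<bar> = (if q = p + 1 \<or> p = q + 1 then 1 else 0)"
    by (elim exE conjE)
  note anti = quiver_antisym[OF skew]
  \<comment> \<open>An arrow forward along the path is produced by a move of the left end.\<close>
  define L where "L p \<longleftrightarrow> B $ f p $ f (Suc p) = 1" for p
  define g where "g = inv_into {1..?N} f"
  have g: "g i \<in> {1..?N}" "f (g i) = i" for i
    using f unfolding g_def bij_betw_def by (metis UNIV_I inv_into_into, metis UNIV_I f_inv_into_f)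
  have gf: "g (f p) = p" if "p \<in> {1..?N}" for p
    using f that unfolding g_def bij_betw_def by simp
  define D where "D i = nested L (g i)" for i
  define F where "F = insert (nested L (?N + 1)) (range (\<lambda>x. {x, x + 1}))"
  let ?E = "F \<union> range D"
  have edges: "e \<in> ?E \<longleftrightarrow> (\<exists>x. e = {x, x + 1}) \<or> (\<exists>m\<le>?N + 1. e = nested L m)" for e
  proof -
    have "nested L m \<in> ?E" if "m \<le> ?N + 1" for m
    proof -
      consider "m = 0" | "m \<in> {1..?N}" | "m = ?N + 1" using \<open>m \<le> ?N + 1\<close> by fastforce
      then show ?thesis
      proof cases
        case 1
        then have "nested L m = {0, 0 + 1}" by (simp add: nested_def)
        then show ?thesis unfolding F_def by blast
      next
        case 2
        then have "nested L m = D (f m)" unfolding D_def gf[OF 2] by simp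
        then show ?thesis by blast
      next
        case 3
        then show ?thesis unfolding F_def by blast
      qed
    qed
    moreover have "\<exists>m\<le>?N + 1. D i = nested L m" for i
      using g(1)[of i] unfolding D_def by (intro exI[of _ "g i"]) auto
    ultimately show ?thesis unfolding F_def by blast
  qed
  have not_unit: "nested L m \<noteq> {x, x + 1}" if "m \<ge> 1" for m x
    using nested_width[of L m] that by (auto simp: nested_def doubleton_eq_iff)
  have inj: "inj D"
    unfolding inj_def D_def by (metis g(2) nested_inj)
  have FD: "range D \<inter> F = {}"
  proof -
    have "D i \<notin> F" for i
      using not_unit[of "g i"] g(1)[of i] unfolding D_def F_def by (auto simp: nested_inj)
    then show ?thesis by blast
  qed
  have nc: "noncrossing ?E"
    unfolding noncrossing_def
  proof (intro allI impI notI)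
    fix p q r s
    assume c: "cyclic4 p q r s" and e: "{p, r} \<in> ?E" "{q, s} \<in> ?E"
    have c': "cyclic4 q r s p" using cyclic4_rotate[OF c] .
    show False
      using e unit_edge_noncrossing[OF c] unit_edge_noncrossing[OF c'] nested_noncrossing[OF c]
      unfolding edges by metis
  qed
  define inner where "inner m = (if L m then nested_lo L m else nested_hi L m)" for m
  define outer where "outer m = (if L m then nested_lo L (Suc m) else nested_hi L (Suc m))" for m
  \<comment> \<open>The triangle on either side of a nested diagonal has one side of unit length; its third
    side is the preceding or the following nested diagonal.\<close>
  have sides:
    "{nested_lo L (Suc m), inner m} =
       (if L m then {nested_lo L m - 1, nested_lo L m - 1 + 1} else nested L m)"
    "{inner m, nested_hi L (Suc m)} =
       (if L m then nested L m else {nested_hi L m, nested_hi L m + 1})"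
    "{nested_hi L m, outer m} =
       (if L m then nested L (Suc m) else {nested_hi L m, nested_hi L m + 1})"
    "{outer m, nested_lo L m} =
       (if L m then {nested_lo L m - 1, nested_lo L m - 1 + 1} else nested L (Suc m))" for m
    unfolding inner_def outer_def nested_def by auto
  have Q: "quad ?E (nested L (Suc m)) (nested_lo L (Suc m)) (inner m) (nested_hi L (Suc m)) (outer (Suc m))"
    if "m < ?N" for m
  proof -
    have cyc: "cyclic4 (nested_lo L (Suc m)) (inner m) (nested_hi L (Suc m)) (outer (Suc m))"
      using nested_width[of L m] unfolding cyclic4_def inner_def outer_def by auto
    have unit: "{x, x + 1} \<in> ?E" for x unfolding edges by blast
    have below: "nested L m \<in> ?E" and above: "nested L (Suc (Suc m)) \<in> ?E"
      using that unfolding edges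
      by (intro disjI2 exI[of _ m], simp, intro disjI2 exI[of _ "Suc (Suc m)"], simp)
    have if_mem: "(if P then x else y) \<in> ?E" if "x \<in> ?E" "y \<in> ?E" for P x y
      using that by simp
    show ?thesis unfolding quad_def sides by (intro conjI cyc nested_def if_mem unit below above)
  qed
  have shear: "shear (edge_indicator (nested L q))
      (nested_lo L (Suc m)) (inner m) (nested_hi L (Suc m)) (outer (Suc m)) =
      (if q = Suc (Suc m) then if L (Suc m) then 1 else -1
       else if q = m then if L m then -1 else 1 else 0)" if "q \<ge> 1" for q m
  proof -
    have ne: "{x, x + 1} \<noteq> nested L q" for x using not_unit[OF that] by metis
    have is_nested: "(if P then {x, x + 1} else nested L k) = nested L q \<longleftrightarrow> \<not> P \<and> k = q"
      "(if P then nested L k else {x, x + 1}) = nested L q \<longleftrightarrow> P \<and> k = q" for P x k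
      using ne[of x] by (simp_all add: nested_inj)
    show ?thesis unfolding shear_def sides is_nested by auto
  qed
  have "triangulation_of F D B"
    unfolding triangulation_of_def
  proof (intro conjI allI)
    have quads: "\<exists>m < ?N. g i = Suc m" for i
      using g(1)[of i] by (cases "g i") auto
    show "triangulation F D"
      unfolding triangulation_def
    proof (intro conjI allI inj FD nc)
      fix k
      obtain m where m: "m < ?N" "g k = Suc m" using quads by blast
      show "\<exists>p q r s. quad ?E (D k) p q r s"
        using Q[OF m(1)] unfolding D_def m(2) by blast
    qed
    fix j
    show "shears F D (edge_indicator (D j)) (\<lambda>i. B $ i $ j)"
    proof (rule shearsI[OF nc])
      fix i
      obtain m where m: "m < ?N" "g i = Suc m" using quads by blast
      have gj: "1 \<le> g j" "g j \<le> ?N" using g(1)[of j] by auto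
      have B: "\<bar>B $ f (Suc p) $ f (Suc (Suc p))\<bar> = 1" if "Suc (Suc p) \<le> ?N" for p
        using path that by auto
      have Bij: "B $ i $ j = B $ f (Suc m) $ f (g j)" using g(2) m(2) by metis
      have 0: "B $ f (Suc m) $ f (g j) = 0" if "g j \<noteq> Suc (Suc m)" "g j \<noteq> m"
        using path[rule_format, of "Suc m" "g j"] that m gj by auto
      have up: "B $ f (Suc m) $ f (g j) = (if L (Suc m) then 1 else -1)" if "g j = Suc (Suc m)"
        using B[of m] that gj unfolding L_def by auto
      have down: "B $ f (Suc m) $ f (g j) = (if L m then -1 else 1)" if gm: "g j = m"
      proof -
        obtain p where p: "m = Suc p" using gm gj by (cases m) auto
        have "\<bar>B $ f m $ f (Suc m)\<bar> = 1" using B[of p] p m by simp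
        then show ?thesis using gm anti[of "f (Suc m)" "f m"] unfolding L_def by auto
      qed
      have "B $ i $ j = shear (edge_indicator (D j))
          (nested_lo L (Suc m)) (inner m) (nested_hi L (Suc m)) (outer (Suc m))"
        unfolding Bij D_def shear[OF gj(1)] using 0 up down by auto
      moreover have "quad ?E (D i) (nested_lo L (Suc m)) (inner m) (nested_hi L (Suc m)) (outer (Suc m))"
        using Q[OF m(1)] m(2) unfolding D_def by simp
      ultimately show "\<exists>p q r s. quad ?E (D i) p q r s \<and>
          B $ i $ j = shear (edge_indicator (D j)) p q r s" by blast
    qed
  qed
  then show ?thesis by blast
qed

text \<open>Flips carry the triangulation of the path along the mutation sequence.\<close>

lemma type_A_triangulation:
  fixes B :: "int^'n^'n"
  assumes "quiver_type_A B"
  shows "\<exists>F D. triangulation_of F D B"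
proof -
  obtain B0 w where B0: "dynkin_A_orientation B0" and B: "B = bmat B0 w"
    using assms unfolding quiver_type_A_def mutation_equivalent_def by (elim conjE exE)
  have "\<exists>F D. triangulation_of F D (bmat B0 w)"
  proof (induction w rule: rev_induct)
    case Nil
    then show ?case using path_triangulation[OF B0] by (simp add: bmat_Nil)
  next
    case (snoc k w)
    then obtain F D where "triangulation_of F D (bmat B0 w)" by auto
    from flip_mutates[OF this, of k] show ?case by auto
  qed
  then show ?thesis using B by blast
qed

section \<open>Roots of an even positive definite lattice\<close>

definition gform :: "int^'n^'n \<Rightarrow> int^'n \<Rightarrow> int^'n \<Rightarrow> int" where
  "gform A x y = (\<Sum>i\<in>UNIV. \<Sum>j\<in>UNIV. x $ i * A $ i $ j * y $ j)"

definition even_positive :: "int^'n^'n \<Rightarrow> bool" where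
  "even_positive A \<longleftrightarrow> (\<forall>i j. A $ i $ j = A $ j $ i) \<and> (\<forall>i. A $ i $ i = 2) \<and>
     (\<forall>x. gform A x x \<ge> 0) \<and> (\<forall>x. gform A x x = 0 \<longrightarrow> x = 0)"

definition root_reflection :: "int^'n^'n \<Rightarrow> int^'n \<Rightarrow> int^'n \<Rightarrow> int^'n" where
  "root_reflection A \<beta> x = x - gform A x \<beta> *s \<beta>"

lemma gform_add_left: "gform A (x + y) z = gform A x z + gform A y z"
  and gform_add_right: "gform A z (x + y) = gform A z x + gform A z y"
  and gform_diff_left: "gform A (x - y) z = gform A x z - gform A y z"
  and gform_diff_right: "gform A z (x - y) = gform A z x - gform A z y"
  by (simp_all add: gform_def algebra_simps sum.distrib sum_subtractf)

lemma gform_scale_left: "gform A (c *s x) z = c * gform A x z"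
  and gform_scale_right: "gform A z (c *s x) = c * gform A z x"
  by (simp_all add: gform_def sum_distrib_left algebra_simps)

lemmas gform_linear = gform_add_left gform_add_right gform_diff_left gform_diff_right
  gform_scale_left gform_scale_right

lemma gform_commute:
  assumes "\<forall>i j. A $ i $ j = A $ j $ i"
  shows "gform A x y = gform A y x"
proof -
  have "gform A x y = (\<Sum>j\<in>UNIV. \<Sum>i\<in>UNIV. x $ i * A $ i $ j * y $ j)"
    unfolding gform_def by (rule sum.swap)
  also have "\<dots> = gform A y x"
    unfolding gform_def using assms by (intro sum.cong refl) (simp add: mult.commute mult.left_commute)
  finally show ?thesis .
qed

lemma gform_axis_right: "gform A x (axis i 1) = (\<Sum>j\<in>UNIV. x $ j * A $ j $ i)"
  unfolding gform_def axis_def by (simp add: if_distrib[of "\<lambda>t. _ * t"] cong: if_cong)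

lemma gform_axis: "gform A (axis i 1) (axis j 1) = A $ i $ j"
  unfolding gform_axis_right by (simp add: axis_def if_distrib[of "\<lambda>t. t * _"] cong: if_cong)

lemma gim_reflection_eq_root_reflection: "gim_reflection A i = root_reflection A (axis i 1)"
  unfolding fun_eq_iff vec_eq_iff root_reflection_def gform_axis_right
  by (simp add: gim_reflection_nth) (simp add: axis_def)

lemma root_reflection_conjugate:
  assumes A: "even_positive A" and "gform A \<beta> \<beta> = 2"
  shows "root_reflection A \<beta> \<circ> root_reflection A \<delta> \<circ> root_reflection A \<beta> =
    root_reflection A (root_reflection A \<beta> \<delta>)"
proof
  fix x
  have comm: "gform A x y = gform A y x" for x y
    using A gform_commute unfolding even_positive_def by blast
  show "(root_reflection A \<beta> \<circ> root_reflection A \<delta> \<circ> root_reflection A \<beta>) x =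
      root_reflection A (root_reflection A \<beta> \<delta>) x"
    using assms(2) comm[of \<beta> \<delta>]
    by (simp add: root_reflection_def gform_linear vec_eq_iff algebra_simps)
qed

lemma gform_root_reflection:
  assumes A: "even_positive A" and "gform A \<beta> \<beta> = 2"
  shows "gform A (root_reflection A \<beta> x) (root_reflection A \<beta> y) = gform A x y"
  using assms gform_commute[of A \<beta> y]
  unfolding even_positive_def by (simp add: root_reflection_def gform_linear algebra_simps)

text \<open>The off-diagonal terms occur in equal pairs.\<close>

lemma even_gform_self:
  assumes A: "even_positive A"
  shows "even (gform A x x)"
proof -
  have sym: "A $ i $ j = A $ j $ i" and diag: "A $ i $ i = 2" for i j
    using A unfolding even_positive_def by blast+
  have "even (\<Sum>i\<in>S. \<Sum>j\<in>S. x $ i * A $ i $ j * x $ j)" if "finite S" for S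
    using that
  proof (induction S)
    case (insert k S)
    have "(\<Sum>i\<in>insert k S. \<Sum>j\<in>insert k S. x $ i * A $ i $ j * x $ j) =
       x $ k * A $ k $ k * x $ k + (\<Sum>j\<in>S. x $ k * A $ k $ j * x $ j) +
       (\<Sum>i\<in>S. x $ i * A $ i $ k * x $ k) + (\<Sum>i\<in>S. \<Sum>j\<in>S. x $ i * A $ i $ j * x $ j)"
      using insert by (simp add: sum.distrib)
    also have "(\<Sum>i\<in>S. x $ i * A $ i $ k * x $ k) = (\<Sum>j\<in>S. x $ k * A $ k $ j * x $ j)"
      by (intro sum.cong refl) (simp add: sym[of _ k] mult.commute mult.left_commute)
    finally show ?case using insert.IH diag[of k] by simp
  qed simp
  then show ?thesis unfolding gform_def by simp
qed

text \<open>Half the sum and half the difference are lattice vectors whose even, nonnegative square lengths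
  add up to 2, so one of them is zero.\<close>

lemma root_reflection_cong_mod_2:
  assumes A: "even_positive A" and 2: "gform A \<beta> \<beta> = 2" "gform A \<delta> \<delta> = 2"
    and par: "\<And>l. even (\<beta> $ l) = even (\<delta> $ l)"
  shows "root_reflection A \<beta> = root_reflection A \<delta>"
proof -
  define u where "u = (\<chi> l. (\<beta> $ l + \<delta> $ l) div 2)"
  define v where "v = (\<chi> l. (\<beta> $ l - \<delta> $ l) div 2)"
  have "even (\<beta> $ l + \<delta> $ l)" "even (\<beta> $ l - \<delta> $ l)" for l using par[of l] by simp_all
  then have "2 * (u $ l) = \<beta> $ l + \<delta> $ l" "2 * (v $ l) = \<beta> $ l - \<delta> $ l" for l
    unfolding u_def v_def by simp_all
  then have uv: "u $ l + v $ l = \<beta> $ l" "u $ l - v $ l = \<delta> $ l" for l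
    by (smt (verit))+
  then have \<beta>: "\<beta> = u + v" and \<delta>: "\<delta> = u - v" by (simp_all add: vec_eq_iff)
  have "gform A u u + gform A v v = 2"
    using 2 unfolding \<beta> \<delta> by (simp add: gform_linear)
  moreover have "even (gform A u u)" "even (gform A v v)" "gform A u u \<ge> 0" "gform A v v \<ge> 0"
    using A even_gform_self unfolding even_positive_def by blast+
  ultimately have "gform A u u = 0 \<or> gform A v v = 0" by presburger
  then have "u = 0 \<or> v = 0" using A unfolding even_positive_def by blast
  then have "\<beta> = \<delta> \<or> \<beta> = - \<delta>" using \<beta> \<delta> by auto
  then show ?thesis
  proof
    assume m: "\<beta> = - \<delta>"
    have "gform A x (- \<delta>) = - gform A x \<delta>" for x
      using gform_diff_right[of A x 0 \<delta>] gform_scale_right[of A x 0 0] by simp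
    then show ?thesis unfolding m by (simp add: fun_eq_iff root_reflection_def vec_eq_iff)
  qed simp
qed

section \<open>A positive definite generalized intersection matrix\<close>

text \<open>The vertices are listed in increasing order.  A triangle is determined by its middle vertex, so
  middle vertices serve as names of triangles.\<close>

definition triangle :: "int set set \<Rightarrow> int \<Rightarrow> int \<Rightarrow> int \<Rightarrow> bool" where
  "triangle E x y z \<longleftrightarrow> x < y \<and> y < z \<and> {x, y} \<in> E \<and> {y, z} \<in> E \<and> {x, z} \<in> E"

lemma noncrossing_less:
  "noncrossing E \<Longrightarrow> p < q \<Longrightarrow> q < r \<Longrightarrow> r < s \<Longrightarrow> {p, r} \<in> E \<Longrightarrow> {q, s} \<in> E \<Longrightarrow> False"
  using noncrossingD[of E p q r s] unfolding cyclic4_def by blast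

lemma triangle_middle_unique:
  assumes E: "noncrossing E" and 1: "triangle E x y z" and 2: "triangle E x' y z'"
  shows "x' = x \<and> z' = z"
proof -
  have key: "\<not> x' < x" if "triangle E x y z" "triangle E x' y z'" for x z x' z'
  proof
    assume "x' < x"
    then show False
      using that noncrossing_less[OF E, of x' x y z] unfolding triangle_def by blast
  qed
  have key': "\<not> z < z'" if "triangle E x y z" "triangle E x' y z'" for x z x' z'
  proof
    assume "z < z'"
    then show False
      using that noncrossing_less[OF E, of x y z z'] unfolding triangle_def by blast
  qed
  show ?thesis using key[OF 1 2] key[OF 2 1] key'[OF 1 2] key'[OF 2 1] by simp
qed

lemma sum_two_points:
  fixes s s' :: int
  assumes "finite V" "x \<in> V" "y \<in> V"
  shows "(\<Sum>m\<in>V. (of_bool (m = x) + s * of_bool (m = y)) * (of_bool (m = x') + s' * of_bool (m = y'))) =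
    of_bool (x = x') + s' * of_bool (x = y') + s * of_bool (y = x') + s * s' * of_bool (y = y')"
proof -
  have "(\<Sum>m\<in>V. (of_bool (m = x) + s * of_bool (m = y)) * (of_bool (m = x') + s' * of_bool (m = y'))) =
    (\<Sum>m\<in>V. (if m = x then of_bool (x = x') + s' * of_bool (x = y') else 0)) +
    (\<Sum>m\<in>V. (if m = y then s * of_bool (y = x') + s * s' * of_bool (y = y') else 0))"
    unfolding sum.distrib[symmetric] by (intro sum.cong refl) (simp add: algebra_simps)
  then show ?thesis using assms by simp
qed

text \<open>Each diagonal \<open>{a, b}\<close> lies in a lower triangle, where it is the longest side, and in an
  upper triangle, where it is the left or the right short side.  Assign to it the vector
  with entry 1 at the lower triangle and entry 1 or -1 at the upper one, the sign
  telling left from right.  The Gram matrix of these vectors is the generalized intersection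
  matrix of the ordering, hence the quadratic form is a sum of squares over the
  triangles.  If all squares vanish at \<open>x\<close>, then the coordinate of \<open>x\<close> at the longest side of each
  triangle is determined by those at the short sides, and \<open>x = 0\<close> follows by induction on
  the length of the diagonals.\<close>

lemma triangulation_even_positive:
  fixes B :: "int^'n^'n"
  assumes T: "triangulation_of F D B" and B: "quiver B"
  shows "\<exists>prec. strict_linear_order prec \<and> even_positive (gim prec B)"
proof -
  let ?E = "F \<union> range D"
  have T': "triangulation F D" and shears: "\<forall>j. shears F D (edge_indicator (D j)) (\<lambda>i. B $ i $ j)"
    using T unfolding triangulation_of_def by (rule conjunct1, rule conjunct2)
  have inj: "inj D" and E: "noncrossing ?E" and quads: "\<forall>k. \<exists>p q r s. quad ?E (D k) p q r s"
    using T' unfolding triangulation_def by simp_all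
  have "\<exists>a c b d. quad ?E (D k) a c b d \<and> a < b" for k
  proof -
    obtain p q r s where Q: "quad ?E (D k) p q r s" using quads by (elim allE exE)
    then have "cyclic4 p q r s" unfolding quad_def by (rule conjunct1)
    then have "p < r \<or> r < p" using cyclic4_distinct[of p q r s] by linarith
    then show ?thesis using Q quad_rotate[OF Q] by blast
  qed
  then obtain a c b d where Q: "\<And>k. quad ?E (D k) (a k) (c k) (b k) (d k)" and ab: "\<And>k. a k < b k"
    by metis
  have D: "D k = {a k, b k}" for k using Q unfolding quad_def by blast
  have DE: "{a k, b k} \<in> ?E" for k using D by (metis UnI2 rangeI)
  have cd: "a k < c k" "c k < b k" "d k < a k \<or> b k < d k" for k
  proof -
    have "cyclic4 (a k) (c k) (b k) (d k)" using Q[of k] unfolding quad_def by (rule conjunct1)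
    then show "a k < c k" "c k < b k" "d k < a k \<or> b k < d k"
      using ab[of k] unfolding cyclic4_def by (smt (verit))+
  qed
  have eq: "i = j" if "a i = a j" "b i = b j" for i j
    using that D inj by (metis injD)
  have D_eq: "D j = {x, y} \<longleftrightarrow> a j = x \<and> b j = y" if "x < y" for j x y
    using that ab[of j] unfolding D doubleton_eq_iff by auto
  \<comment> \<open>\<open>e k\<close> is the middle vertex of the upper triangle of the \<open>k\<close>-th diagonal, while \<open>c k\<close> is
    that of the lower triangle.\<close>
  define sg :: "'n \<Rightarrow> int" where "sg k = (if b k < d k then 1 else -1)" for k
  define e where "e k = (if b k < d k then b k else a k)" for k
  have lower: "triangle ?E (a k) (c k) (b k)" for k
    using Q[of k] cd[of k] DE unfolding quad_def triangle_def by blast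
  have upper1: "triangle ?E (a k) (b k) (d k)" if "b k < d k" for k
    using Q[of k] ab[of k] DE[of k] that unfolding quad_def triangle_def by (simp add: insert_commute)
  have upper2: "triangle ?E (d k) (a k) (b k)" if "\<not> b k < d k" for k
    using Q[of k] ab[of k] DE[of k] cd[of k] that unfolding quad_def triangle_def by (simp add: insert_commute)
  have middle: "b j < d j \<and> a j = x \<and> b j = y \<and> d j = z \<or> \<not> b j < d j \<and> a j = y \<and> b j = z \<and> d j = x"
    if "triangle ?E x y z" "e j = y" for j x y z
    using triangle_middle_unique[OF E that(1)] upper1[of j] upper2[of j] that(2)
    unfolding e_def by (metis (full_types))
  have short_side: "b j < d j \<and> d j = z" if t: "triangle ?E x y z" and "a j = x" "b j = y" for j x y z
  proof (cases "b j < d j")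
    case True
    then show ?thesis using triangle_middle_unique[OF E t, of x "d j"] upper1[of j] that by simp
  next
    case False
    then show ?thesis
      using noncrossing_less[OF E, of "d j" x y z] upper2[of j] t that unfolding triangle_def by simp
  qed
  have middle_side: "\<not> b j < d j \<and> d j = x" if t: "triangle ?E x y z" and "a j = y" "b j = z" for j x y z
  proof (cases "b j < d j")
    case False
    then show ?thesis using triangle_middle_unique[OF E t, of "d j" z] upper2[of j] that by simp
  next
    case True
    then show ?thesis
      using noncrossing_less[OF E, of x y z "d j"] upper1[of j] t that unfolding triangle_def by simp
  qed
  have sides: "D j = {x, y} \<longleftrightarrow> e j = y \<and> b j < d j" "D j = {y, z} \<longleftrightarrow> e j = y \<and> \<not> b j < d j"
    if t: "triangle ?E x y z" for j x y z
  proof -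
    have less: "x < y" "y < z" using t unfolding triangle_def by simp_all
    show "D j = {x, y} \<longleftrightarrow> e j = y \<and> b j < d j"
      unfolding D_eq[OF less(1)] using middle[OF t, of j] short_side[OF t, of j]
      unfolding e_def by (cases "b j < d j") auto
    show "D j = {y, z} \<longleftrightarrow> e j = y \<and> \<not> b j < d j"
      unfolding D_eq[OF less(2)] using middle[OF t, of j] middle_side[OF t, of j]
      unfolding e_def by (cases "b j < d j") auto
  qed
  define prec where "prec = {(i, j). b j < b i \<or> b i = b j \<and> a i < a j}"
  have slo: "strict_linear_order prec"
    unfolding strict_linear_order_on_def
  proof (intro conjI)
    show "trans prec" unfolding trans_def prec_def by auto
    show "irrefl prec" unfolding irrefl_def prec_def by auto
    show "total prec" unfolding total_on_def prec_def by simp (metis eq linorder_less_linear)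
  qed
  define v where "v k m = of_bool (m = c k) + sg k * of_bool (m = e k)" for k and m :: int
  define V where "V = range c \<union> range e"
  have V: "finite V" "c k \<in> V" "e k \<in> V" for k unfolding V_def by auto
  have gram: "(\<Sum>m\<in>V. v i m * v j m) =
      of_bool (c i = c j) + sg j * of_bool (c i = e j) + sg i * of_bool (e i = c j) +
      sg i * sg j * of_bool (e i = e j)" for i j
    unfolding v_def by (rule sum_two_points[OF V])
  have gram_prec: "(\<Sum>m\<in>V. v i m * v j m) = B $ i $ j" if ij: "(i, j) \<in> prec" for i j
  proof -
    have ord: "b j < b i \<or> b i = b j \<and> a i < a j" using ij unfolding prec_def by simp
    have Bij: "B $ i $ j = of_bool (D j = {a i, c i}) + of_bool (D j = {b i, d i})
        - of_bool (D j = {c i, b i}) - of_bool (D j = {d i, a i})"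
      using shears Q[of i] unfolding shears_def shear_def by (auto simp: eq_commute)
    \<comment> \<open>The longest side comes first among the sides of a triangle, and the right short side comes
      before the left one; so the later diagonal \<open>j\<close> cannot have the triangle below it in
      common with \<open>i\<close>.\<close>
    have cc: "c i \<noteq> c j"
      using triangle_middle_unique[OF E lower[of i], of "a j" "b j"] lower[of j] ord by auto
    have ec: "e i \<noteq> c j"
      using middle[OF lower[of j], of i] ord cd[of j] cd[of i] by auto
    have ce: "sg j * of_bool (c i = e j) = of_bool (D j = {a i, c i}) - of_bool (D j = {c i, b i})"
      unfolding sides[OF lower] sg_def by simp
    have not_i: "D j \<noteq> {a i, b i}" unfolding D_eq[OF ab] using ord by (smt (verit))
    have ee: "sg i * sg j * of_bool (e i = e j) = of_bool (D j = {b i, d i}) - of_bool (D j = {d i, a i})"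
    proof (cases "b i < d i")
      case True
      have "a i < d i" using True ab[of i] by simp
      then have "D j \<noteq> {a i, d i}" "D j \<noteq> {b i, d i}"
        unfolding D_eq[OF True] D_eq[OF \<open>a i < d i\<close>] using ord True by (smt (verit))+
      moreover from this have "e j \<noteq> b i"
        using not_i sides[OF upper1[OF True], of j] by blast
      ultimately show ?thesis using True by (simp add: e_def insert_commute)
    next
      case False
      then have da: "d i < a i" "d i < b i" using cd[of i] ab[of i] by auto
      have "D j \<noteq> {d i, b i}"
        unfolding D_eq[OF da(2)] using da ord by (smt (verit))
      then have far: "D j \<noteq> {b i, d i}" by (simp add: insert_commute)
      have ei: "e i = a i" "sg i = -1" using False unfolding e_def sg_def by simp_all
      have near: "D j = {d i, a i} \<longleftrightarrow> e j = a i" and "e j = a i \<longrightarrow> b j < d j"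
        using not_i sides[OF upper2[OF False], of j] by blast+
      then have "e j = a i \<longrightarrow> sg j = 1" unfolding sg_def by simp
      then show ?thesis unfolding ei near using far by (cases "e j = a i") simp_all
    qed
    show ?thesis unfolding gram Bij using cc ec ce ee by simp
  qed
  have gram_commute: "(\<Sum>m\<in>V. v i m * v j m) = (\<Sum>m\<in>V. v j m * v i m)" for i j
    by (simp add: mult.commute)
  have gim: "gim prec B $ i $ j = (\<Sum>m\<in>V. v i m * v j m)" for i j
  proof -
    consider "i = j" | "i \<noteq> j" "(i, j) \<in> prec" | "i \<noteq> j" "(i, j) \<notin> prec" "(j, i) \<in> prec"
      using slo unfolding strict_linear_order_on_def total_on_def by blast
    then show ?thesis
    proof cases
      case 1
      have "c i \<noteq> e i" using cd[of i] unfolding e_def by auto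
      then show ?thesis unfolding 1[symmetric] gram by (auto simp: gim_def sg_def)
    next
      case 2
      then show ?thesis using gram_prec by (simp add: gim_def)
    next
      case 3
      then show ?thesis
        using gram_prec[of j i] gram_commute[of i j] quiver_antisym[OF B, of i j] by (simp add: gim_def)
    qed
  qed
  have square: "gform (gim prec B) x x = (\<Sum>m\<in>V. (\<Sum>i\<in>UNIV. x $ i * v i m)\<^sup>2)" for x
  proof -
    have "gform (gim prec B) x x = (\<Sum>i\<in>UNIV. \<Sum>j\<in>UNIV. \<Sum>m\<in>V. x $ i * v i m * (x $ j * v j m))"
      unfolding gform_def gim sum_distrib_left sum_distrib_right
      by (intro sum.cong refl) (simp add: algebra_simps)
    also have "\<dots> = (\<Sum>i\<in>UNIV. \<Sum>m\<in>V. \<Sum>j\<in>UNIV. x $ i * v i m * (x $ j * v j m))"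
      by (intro sum.cong refl sum.swap)
    also have "\<dots> = (\<Sum>m\<in>V. \<Sum>i\<in>UNIV. \<Sum>j\<in>UNIV. x $ i * v i m * (x $ j * v j m))"
      by (rule sum.swap)
    also have "\<dots> = (\<Sum>m\<in>V. (\<Sum>i\<in>UNIV. x $ i * v i m)\<^sup>2)"
      by (simp add: power2_eq_square sum_product)
    finally show ?thesis .
  qed
  have definite: "x = 0" if "gform (gim prec B) x x = 0" for x
  proof -
    have "\<forall>m\<in>V. (\<Sum>i\<in>UNIV. x $ i * v i m)\<^sup>2 = 0"
      using that V(1) unfolding square by (subst (asm) sum_nonneg_eq_0_iff) auto
    then have zero: "(\<Sum>i\<in>UNIV. x $ i * v i m) = 0" if "m \<in> V" for m using that by simp
    have "x $ k = 0" for k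
    proof (induction "nat (b k - a k)" arbitrary: k rule: less_induct)
      case less
      have "x $ i * v i (c k) = (if i = k then x $ k else 0)" for i
      proof (cases "i = k")
        case True
        have "c k \<noteq> e k" using cd[of k] unfolding e_def by auto
        then show ?thesis using True unfolding v_def by simp
      next
        case False
        have "c k \<noteq> c i"
          using triangle_middle_unique[OF E lower[of k], of "a i" "b i"] lower[of i] eq False by auto
        moreover have "x $ i = 0" if "c k = e i"
          using middle[OF lower[of k], of i] that cd[of k] by (intro less) auto
        ultimately show ?thesis using False unfolding v_def by auto
      qed
      then show ?case using zero[OF V(2)[of k]] by simp
    qed
    then show ?thesis by (simp add: vec_eq_iff)
  qed
  have "even_positive (gim prec B)"
    unfolding even_positive_def
  proof (intro conjI allI impI)
    show "gim prec B $ i $ j = gim prec B $ j $ i" for i j unfolding gim by (rule gram_commute)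
    show "gim prec B $ i $ i = 2" for i by (simp add: gim_def)
    show "0 \<le> gform (gim prec B) x x" for x unfolding square by (simp add: sum_nonneg)
    show "gform (gim prec B) x x = 0 \<Longrightarrow> x = 0" for x by (rule definite)
  qed
  then show ?thesis using slo by blast
qed

section \<open>Reflections and c-vectors modulo 2\<close>

text \<open>The correction term of the mutation rule in a form that visibly changes sign
  when the signs of \<open>u\<close> and \<open>v\<close> are changed and the two are interchanged.\<close>

lemma mutation_term:
  fixes u v :: int
  shows "sgn u * max (u * v) 0 =
    (if 0 < u \<and> 0 < v then u * v else if u < 0 \<and> v < 0 then - (u * v) else 0)"
proof -
  consider "u = 0" | "v = 0" | "0 < u" "0 < v" | "0 < u" "v < 0" | "u < 0" "0 < v" | "u < 0" "v < 0"
    by linarith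
  then show ?thesis
  proof cases
    case 3
    then show ?thesis using mult_pos_pos[of u v] by simp
  next
    case 4
    then show ?thesis using mult_pos_neg[of u v] by simp
  next
    case 5
    then show ?thesis using mult_neg_pos[of u v] by simp
  next
    case 6
    then show ?thesis using mult_neg_neg[of u v] by simp
  qed simp_all
qed

lemma bmat_antisym:
  assumes "quiver B"
  shows "bmat B w $ i $ j = - bmat B w $ j $ i"
proof (induction w arbitrary: i j rule: rev_induct)
  case Nil
  show ?case unfolding bmat_Nil by (rule quiver_antisym[OF assms])
next
  case (snoc k w)
  let ?b = "bmat B w"
  have flipped: "?b $ j $ i = - ?b $ i $ j" "?b $ j $ k = - ?b $ k $ j" "?b $ k $ i = - ?b $ i $ k"
    by (rule snoc)+
  have "sgn (?b $ j $ k) * max (?b $ j $ k * ?b $ k $ i) 0 =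
      - (sgn (?b $ i $ k) * max (?b $ i $ k * ?b $ k $ j) 0)"
    unfolding flipped(2,3) mutation_term by (simp add: mult.commute)
  then show ?case
    using flipped(1) by (auto simp: bmat_snoc)
qed

text \<open>When \<open>\<beta>\<^sub>i\<close> is reflected, it changes by a multiple of \<open>\<beta>\<^sub>k\<close> that is congruent to \<open>b\<^sub>i\<^sub>k\<close> modulo 2, exactly
  as \<open>c\<^sub>i\<close> changes by a multiple of \<open>c\<^sub>k\<close>.  For the inner products, reflecting both or neither of
  \<open>\<beta>\<^sub>i\<close>, \<open>\<beta>\<^sub>j\<close> changes nothing, and in these cases no path from \<open>i\<close> to \<open>j\<close> or back passes through \<open>k\<close>;
  reflecting one of them changes the inner product by the product of those with \<open>\<beta>\<^sub>k\<close>, which is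
  the change of \<open>b\<^sub>i\<^sub>j\<close> up to sign.\<close>

lemma reflections_of_roots:
  fixes B :: "int^'n^'n"
  assumes T: "triangulation_of F D B" and B: "quiver B" and A: "even_positive (gim prec B)"
  shows "\<exists>\<beta>. \<forall>i. gim_rep prec B (refl_elem B w i) = root_reflection (gim prec B) (\<beta> i) \<and>
    gform (gim prec B) (\<beta> i) (\<beta> i) = 2 \<and>
    (\<forall>j. even (gform (gim prec B) (\<beta> i) (\<beta> j)) = even (bmat B w $ i $ j)) \<and>
    (\<forall>l. even (\<beta> i $ l) = even (cmat B w $ i $ l))"
proof (induction w rule: rev_induct)
  case Nil
  have "even (gim prec B $ i $ j) = even (B $ i $ j)" for i j
    using quiver_antisym[OF B, of i i] unfolding gim_def by auto
  moreover have "gim prec B $ i $ i = 2" for i by (simp add: gim_def)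
  moreover have "even ((axis i 1 :: int^'n) $ l) = even ((mat 1 :: int^'n^'n) $ i $ l)" for i l
    by (simp add: axis_def mat_def)
  ultimately show ?case
    by (intro exI[of _ "\<lambda>i. axis i 1"])
      (simp add: gform_axis gim_rep_gen gim_reflection_eq_root_reflection bmat_Nil cmat_Nil)
next
  case (snoc k w)
  let ?A = "gim prec B"
  let ?b = "bmat B w" and ?c = "cmat B w"
  obtain \<beta> where rep: "\<And>i. gim_rep prec B (refl_elem B w i) = root_reflection ?A (\<beta> i)"
    and norm: "\<And>i. gform ?A (\<beta> i) (\<beta> i) = 2"
    and Gb: "\<And>i j. even (gform ?A (\<beta> i) (\<beta> j)) = even (?b $ i $ j)"
    and \<beta>c: "\<And>i l. even (\<beta> i $ l) = even (?c $ i $ l)"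
    using snoc by metis
  define G where "G i j = gform ?A (\<beta> i) (\<beta> j)" for i j
  have G_commute: "G i j = G j i" for i j
    using A gform_commute unfolding even_positive_def G_def by blast
  have b_antisym: "?b $ i $ j = - ?b $ j $ i" for i j by (rule bmat_antisym[OF B])
  have bkk: "?b $ k $ k = 0" using b_antisym[of k k] by simp
  \<comment> \<open>A zero \<open>c\<close>-vector would make \<open>\<beta>\<^sub>k\<close> divisible by 2 and its square length divisible by 4.\<close>
  have "\<exists>l. ?c $ k $ l \<noteq> 0"
  proof (rule ccontr)
    assume "\<not> ?thesis"
    then have "even (\<beta> k $ l)" for l using \<beta>c by simp
    then have "\<beta> k = 2 *s (\<chi> l. \<beta> k $ l div 2)" by (simp add: vec_eq_iff)
    then obtain \<gamma> where "\<beta> k = 2 *s \<gamma>" by blast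
    then have "4 * gform ?A \<gamma> \<gamma> = 2" using norm[of k] by (simp add: gform_linear)
    then show False by presburger
  qed
  then obtain l0 where l0: "?c $ k $ l0 \<noteq> 0" by blast
  obtain \<epsilon> :: int where \<epsilon>: "\<epsilon> = 1 \<or> \<epsilon> = -1" and coherent: "\<And>l. 0 \<le> \<epsilon> * ?c $ k $ l"
  proof (cases "\<forall>l. ?c $ k $ l \<ge> 0")
    case True
    then show ?thesis using that[of 1] by simp
  next
    case False
    then have "\<forall>l. ?c $ k $ l \<le> 0" using sign_coherence[OF T] by blast
    then show ?thesis using that[of "-1"] by simp
  qed
  \<comment> \<open>With the sign \<open>\<epsilon>\<close> of the \<open>k\<close>-th \<open>c\<close>-vector, the vector condition for conjugating \<open>r\<^sub>i\<close>
    becomes the numerical condition \<open>t i\<close>.\<close>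
  define t where "t i \<longleftrightarrow> 0 < ?b $ i $ k * \<epsilon>" for i
  have bc: "?b $ i $ k * ?c $ k $ l = (?b $ i $ k * \<epsilon>) * (\<epsilon> * ?c $ k $ l)" for i l
    using \<epsilon> by auto
  have tpos: "0 \<le> ?b $ i $ k * ?c $ k $ l" if "t i" for i l
    using that coherent[of l] unfolding bc t_def by simp
  have tneg: "?b $ i $ k * ?c $ k $ l \<le> 0" if "\<not> t i" for i l
    unfolding bc by (rule mult_nonpos_nonneg) (use that coherent[of l] in \<open>simp_all add: t_def not_less\<close>)
  have t_iff: "?b $ i $ k *s cvec B w k > 0 \<longleftrightarrow> t i" for i
  proof -
    have entry: "(?b $ i $ k *s cvec B w k) $ l = ?b $ i $ k * ?c $ k $ l" for l
      by (simp add: cvec_def row_def)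
    show ?thesis
    proof (cases "t i")
      case True
      then have "?b $ i $ k * ?c $ k $ l0 \<noteq> 0" using l0 unfolding t_def by auto
      then have "0 < ?b $ i $ k * ?c $ k $ l0" using tpos[OF True, of l0] by linarith
      then show ?thesis
        using True tpos[OF True] unfolding less_vec_def less_eq_vec_def entry by (auto simp: not_le)
    next
      case False
      then show ?thesis
        using tneg[OF False] unfolding less_vec_def less_eq_vec_def entry by auto
    qed
  qed
  have tk: "\<not> t k" unfolding t_def bkk by simp
  define \<beta>' where "\<beta>' i = (if t i then root_reflection ?A (\<beta> k) (\<beta> i) else \<beta> i)" for i
  have rr: "root_reflection ?A (\<beta> k) (\<beta> i) = \<beta> i - G i k *s \<beta> k" for i
    unfolding root_reflection_def G_def ..
  have rep': "gim_rep prec B (refl_elem B (w @ [k]) i) = root_reflection ?A (\<beta>' i)" for i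
    using root_reflection_conjugate[OF A norm[of k], of "\<beta> i"]
    by (simp add: t_iff \<beta>'_def gim_rep_mult rep o_assoc)
  have Gkk: "G k k = 2" unfolding G_def by (rule norm)
  have G': "gform ?A (\<beta>' i) (\<beta>' j) = (if t i = t j then G i j else G i j - G i k * G k j)" for i j
    using gform_root_reflection[OF A norm[of k], of "\<beta> i" "\<beta> j"] G_commute[of j k] G_commute[of i k]
    unfolding \<beta>'_def by (simp add: rr gform_linear G_def[symmetric] Gkk algebra_simps)
  have norm': "gform ?A (\<beta>' i) (\<beta>' i) = 2" for i
    using norm[of i] unfolding G' G_def by simp
  have Gb': "even (gform ?A (\<beta>' i) (\<beta>' j)) = even (bmat B (w @ [k]) $ i $ j)" for i j
  proof -
    have par: "even (G i j) = even (?b $ i $ j)" for i j unfolding G_def by (rule Gb)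
    show ?thesis
    proof (cases "i = k \<or> j = k")
      case True
      then show ?thesis unfolding G' bmat_snoc using par[of i j] Gkk by auto
    next
      case False
      have bjk: "?b $ j $ k = - ?b $ k $ j" by (rule b_antisym)
      show ?thesis
      proof (cases "t i = t j")
        case True
        then have "?b $ i $ k * ?b $ k $ j \<le> 0"
          using \<epsilon> unfolding t_def bjk by (auto simp: mult_le_0_iff)
        then show ?thesis unfolding G' bmat_snoc using True False par[of i j] by simp
      next
        case ne: False
        then have "0 \<le> ?b $ i $ k * ?b $ k $ j"
          using \<epsilon> unfolding t_def bjk by (auto simp: zero_le_mult_iff)
        then show ?thesis
          unfolding G' bmat_snoc using ne False par[of i j] par[of i k] par[of k j]
          by (auto simp: sgn_if)
      qed
    qed
  qed
  have \<beta>c': "even (\<beta>' i $ l) = even (cmat B (w @ [k]) $ i $ l)" for i l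
  proof (cases "i = k")
    case True
    then show ?thesis using tk \<beta>c unfolding \<beta>'_def cmat_snoc by simp
  next
    case False
    show ?thesis
    proof (cases "t i")
      case True
      then show ?thesis
        using False tpos[OF True, of l] \<beta>c Gb[of i k]
        unfolding \<beta>'_def cmat_snoc rr by (auto simp: sgn_if G_def)
    next
      case nt: False
      then show ?thesis
        using False tneg[OF nt, of l] \<beta>c unfolding \<beta>'_def cmat_snoc by simp
    qed
  qed
  show ?case using rep' norm' Gb' \<beta>c' by blast
qed

theorem theorem2p9:
  fixes B :: "int^'n^'n"
  assumes "quiver_type_A B"
  shows "\<exists>prec. pseudo_acyclic_ordering B prec"
proof -
  have B: "quiver B" using assms unfolding quiver_type_A_def by (rule conjunct1)
  obtain F D where T: "triangulation_of F D B" using type_A_triangulation[OF assms] by blast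
  obtain prec where prec: "strict_linear_order prec" and A: "even_positive (gim prec B)"
    using triangulation_even_positive[OF T B] by blast
  have "gim_rep prec B (refl_elem B w i) = gim_rep prec B (refl_elem B v i)"
    if C: "cmat B w = cmat B v" for w v i
  proof -
    obtain \<beta> where \<beta>: "gim_rep prec B (refl_elem B w i) = root_reflection (gim prec B) (\<beta> i)"
      "gform (gim prec B) (\<beta> i) (\<beta> i) = 2" "\<And>l. even (\<beta> i $ l) = even (cmat B w $ i $ l)"
      using reflections_of_roots[OF T B A, of w] by blast
    obtain \<delta> where \<delta>: "gim_rep prec B (refl_elem B v i) = root_reflection (gim prec B) (\<delta> i)"
      "gform (gim prec B) (\<delta> i) (\<delta> i) = 2" "\<And>l. even (\<delta> i $ l) = even (cmat B v $ i $ l)"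
      using reflections_of_roots[OF T B A, of v] by blast
    show ?thesis
      unfolding \<beta>(1) \<delta>(1) using root_reflection_cong_mod_2[OF A \<beta>(2) \<delta>(2)] \<beta>(3) \<delta>(3) C by simp
  qed
  then show ?thesis using prec unfolding pseudo_acyclic_ordering_def by blast
qed

end
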